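(* Let $\alpha\in\mathbb{C}$. For any $b\in\mathbb{C}$, let $\delta_{\alpha,b}$ be the derivation on $\mathcal{M}_*^{\leq\infty}$ defined by $\delta_{\alpha,b}=b\pi_\alpha+v$. (i) For all $f\in\mathcal{M}_k^{s}$ and $g\in\mathcal{M}_\ell^{t}$, we have $$(f,g)_\alpha=\left(k-(3\alpha+2)s\right)f\,\delta_{\alpha,b}(g)-\left(\ell-(3\alpha+2)t\right)g\,\delta_{\alpha,b}(f).$$ (ii) Moreover, the brackets defined for any integer $n\geq0$ by (bilinear extension of) $$[f,g]_{\delta_{\alpha,b},n}^{\mathcal{K}_\alpha}=\sum_{r=0}^n(-1)^r\binom{k-(3\alpha+2)s+n-1}{n-r}\binom{\ell-(3\alpha+2)t+n-1}{r}\delta_{\alpha,b}^r(f)\,\delta_{\alpha,b}^{n-r}(g),$$ for any $f\in\mathcal{M}_k^{s}$ and $g\in\mathcal{M}_\ell^{t}$, define a formal deformation of $\mathcal{M}_*^{\leq\infty}$ satisfying $$[\mathcal{M}_k^{\leq s},\mathcal{M}_\ell^{\leq t}]_{\delta_{\alpha,b},n}^{\mathcal{K}_\alpha}\subset\mathcal{M}_{k+\ell+2n}^{\leq s+t}$$ for all $n\in\mathbb{N}$, all $k,\ell$ in $2\mathbb{N}$ and all $s,t$ in $\mathbb{N}$, if and only if $b=0$. (That is: the family is a formal deformation and satisfies all these inclusions if and only if $b=0$.)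
   Context: The Eisenstein series (for $\mathrm{SL}(2,\mathbb{Z})$) are $E_2=1-24\sum_{n\ge1}\sigma_1(n)q^n$, $E_4=1+240\sum_{n\ge1}\sigma_3(n)q^n$, $E_6=1-504\sum_{n\ge1}\sigma_5(n)q^n$, $q=e^{2\pi i z}$; they are algebraically independent over $\mathbb{C}$. $\mathcal{M}_*=\mathbb{C}[E_4,E_6]$ is the algebra of modular forms and $\mathcal{M}_*^{\leq\infty}=\mathbb{C}[E_2,E_4,E_6]$ the algebra of quasimodular forms, graded by the weight ($E_j$ has weight $j$). $\mathcal{M}_k$ is the space of modular forms of weight $k$ (weight-$k$ part of $\mathcal{M}_*$). For $k\in2\mathbb{N}$ and $s\in\mathbb{N}$, $\mathcal{M}_k^{s}=\mathcal{M}_{k-2s}E_2^s$ (so elements of $\mathcal{M}_k^s$ have weight $k$), and $\mathcal{M}_k^{\leq s}=\bigoplus_{j=0}^s\mathcal{M}_k^j$ is the space of quasimodular forms of weight $k$ and depth (degree in $E_2$) at most $s$; thus $\mathcal{M}_*^{\leq\infty}=\bigoplus_{k\in2\mathbb{N}}\bigoplus_{s=0}^{k/2}\mathcal{M}_k^s$. $\Delta=E_4^3-E_6^2$. $(\cdot,\cdot)_\alpha$ is the Poisson bracket on $\mathcal{M}_*^{\leq\infty}$ determined by $(E_4,E_6)_\alpha=-2\Delta$, $(E_2,E_4)_\alpha=\alpha E_6E_2$, $(E_2,E_6)_\alpha=\frac32\alpha E_4^2E_2$. The derivation $v$ of $\mathcal{M}_*^{\leq\infty}$ is defined by $v(f)=\frac{(\Delta,f)_\alpha}{12\Delta}$.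 For $f\in\mathcal{M}_k^s$ put $\mathcal{K}_\alpha(f)=k-(3\alpha+2)s$. A derivation $\delta$ on $\mathcal{M}_*^{\leq\infty}$ is complex-like if $\delta(\mathcal{M}_k^{\leq s})\subset\mathcal{M}_{k+2}^{\leq s+1}$ for all $k,s$. The set of complex-like derivations $\delta$ such that $\mathcal{K}_\alpha(f)f\delta(g)-\mathcal{K}_\alpha(g)g\delta(f)=0$ for any $f\in\mathcal{M}_k^{s}$, $g\in\mathcal{M}_\ell^{t}$ and any $k,\ell,s,t$ is a one-dimensional complex vector space; $\pi_\alpha$ denotes a (fixed) generator of it. One such generator is the linear extension of $\pi_\alpha(f)=[k-(3\alpha+2)s]fE_2$ for $f\in\mathcal{M}_k^s$. A family $(\mu_n)_{n\in\mathbb{N}}$ of bilinear maps $A\times A\to A$ on a commutative $\mathbb{C}$-algebra $A$, with $\mu_0$ the product of $A$, is a formal deformation of $A$ if the product on $A[[\hslash]]$ obtained by extension of $f\ast g=\sum_{j\ge0}\mu_j(f,g)\hslash^j$ ($f,g\in A$) is associative, i.e. $\sum_{r=0}^n\mu_{n-r}(\mu_r(f,g),h)=\sum_{r=0}^n\mu_{n-r}(f,\mu_r(g,h))$ for all $f,g,h\in A$ and $n\ge0$. Binomial coefficients with complex upper entry are $\binom{x}{m}=\frac{x(x-1)\cdots(x-m+1)}{m!}$.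
   Formalization: In (ii), "if and only if b=0" is replaced by "if and only if b=0 or α=-1/3": at α=-1/3 the brackets do not depend on b, so they form a formal deformation satisfying all the inclusions for every b, and the claim as stated fails there. *)

theory Defs
  imports "HOL-Analysis.Analysis" "HOL-Library.Function_Algebras"
begin

section \<open>Eisenstein series as functions on the upper half-plane\<close>

typedef upper_half_plane = "{z :: complex. Im z > 0}"
  morphisms uhp_point Abs_uhp
  by (rule exI[of _ \<i>]) simp

definition nome :: "upper_half_plane \<Rightarrow> complex" where
  "nome z = exp (2 * of_real pi * \<i> * uhp_point z)"

definition divisor_sigma :: "nat \<Rightarrow> nat \<Rightarrow> nat" where
  "divisor_sigma k n = (\<Sum>d | d dvd n. d ^ k)"

definition sigma_series :: "nat \<Rightarrow> upper_half_plane \<Rightarrow> complex" where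
  "sigma_series k z = (\<Sum>n. of_nat (divisor_sigma k (Suc n)) * nome z ^ Suc n)"

definition eisenstein2 :: "upper_half_plane \<Rightarrow> complex" where
  "eisenstein2 z = 1 - 24 * sigma_series 1 z"

definition eisenstein4 :: "upper_half_plane \<Rightarrow> complex" where
  "eisenstein4 z = 1 + 240 * sigma_series 3 z"

definition eisenstein6 :: "upper_half_plane \<Rightarrow> complex" where
  "eisenstein6 z = 1 - 504 * sigma_series 5 z"


section \<open>The algebra of quasimodular forms\<close>

text \<open>Ring operations on functions are pointwise.\<close>

definition scale_fun :: "complex \<Rightarrow> (upper_half_plane \<Rightarrow> complex) \<Rightarrow> upper_half_plane \<Rightarrow> complex" where
  "scale_fun c f = (\<lambda>z. c * f z)"

global_interpretation uhp_fun: vector_space scale_fun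
  by unfold_locales (auto simp: scale_fun_def fun_eq_iff algebra_simps)

definition eisenstein_monomials :: "(upper_half_plane \<Rightarrow> complex) set" where
  "eisenstein_monomials = {eisenstein2 ^ i * eisenstein4 ^ j * eisenstein6 ^ l | i j l. True}"

text \<open>The subalgebra generated by the three Eisenstein series is the linear span of their monomials.\<close>

definition quasimodular_functions :: "(upper_half_plane \<Rightarrow> complex) set" where
  "quasimodular_functions = uhp_fun.span eisenstein_monomials"

lemma eisenstein_monomials_1: "1 \<in> eisenstein_monomials"
  unfolding eisenstein_monomials_def
  by (rule CollectI, rule exI[of _ 0], rule exI[of _ 0], rule exI[of _ 0]) simp

lemma eisenstein_monomials_mult:
  assumes "f \<in> eisenstein_monomials" "g \<in> eisenstein_monomials"
  shows "f * g \<in> eisenstein_monomials"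
proof -
  obtain i j l i' j' l'
    where "f = eisenstein2 ^ i * eisenstein4 ^ j * eisenstein6 ^ l"
      and "g = eisenstein2 ^ i' * eisenstein4 ^ j' * eisenstein6 ^ l'"
    using assms unfolding eisenstein_monomials_def by blast
  then have "f * g = eisenstein2 ^ (i + i') * eisenstein4 ^ (j + j') * eisenstein6 ^ (l + l')"
    by (simp add: power_add mult_ac)
  then show ?thesis
    unfolding eisenstein_monomials_def by blast
qed

lemma scale_fun_mult_left: "scale_fun c f * g = scale_fun c (f * g)"
  and scale_fun_mult_right: "f * scale_fun c g = scale_fun c (f * g)"
  by (auto simp: scale_fun_def fun_eq_iff)

lemma quasimodular_functions_mult:
  assumes "f \<in> quasimodular_functions" "g \<in> quasimodular_functions"
  shows "f * g \<in> quasimodular_functions"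
proof -
  have right: "m * g \<in> quasimodular_functions" if m: "m \<in> eisenstein_monomials" for m
    using assms(2) unfolding quasimodular_functions_def
  proof (induction rule: uhp_fun.span_induct_alt)
    case base
    show ?case by (metis mult_zero_right uhp_fun.span_zero)
  next
    case (step c x y)
    have "m * (scale_fun c x + y) = scale_fun c (m * x) + m * y"
      by (simp add: distrib_left scale_fun_mult_right)
    then show ?case
      using step m eisenstein_monomials_mult
      by (metis uhp_fun.span_add uhp_fun.span_base uhp_fun.span_scale)
  qed
  show ?thesis
    using assms(1) unfolding quasimodular_functions_def
  proof (induction rule: uhp_fun.span_induct_alt)
    case base
    show ?case by (metis mult_zero_left uhp_fun.span_zero)
  next
    case (step c x y)
    have "(scale_fun c x + y) * g = scale_fun c (x * g) + y * g"
      by (simp add: distrib_right scale_fun_mult_left)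
    then show ?case
      using step right unfolding quasimodular_functions_def
      by (metis uhp_fun.span_add uhp_fun.span_scale)
  qed
qed

typedef quasimodular = quasimodular_functions
  morphisms quasimodular_fun Abs_quasimodular
  unfolding quasimodular_functions_def by (rule exI[of _ 0]) (rule uhp_fun.span_zero)

setup_lifting type_definition_quasimodular

instantiation quasimodular :: comm_ring_1
begin

lift_definition zero_quasimodular :: quasimodular is 0
  unfolding quasimodular_functions_def by (rule uhp_fun.span_zero)

lift_definition one_quasimodular :: quasimodular is 1
  unfolding quasimodular_functions_def by (rule uhp_fun.span_base, rule eisenstein_monomials_1)

lift_definition plus_quasimodular :: "quasimodular \<Rightarrow> quasimodular \<Rightarrow> quasimodular" is "(+)"
  unfolding quasimodular_functions_def by (rule uhp_fun.span_add)

lift_definition minus_quasimodular :: "quasimodular \<Rightarrow> quasimodular \<Rightarrow> quasimodular" is "(-)"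
  unfolding quasimodular_functions_def by (rule uhp_fun.span_diff)

lift_definition uminus_quasimodular :: "quasimodular \<Rightarrow> quasimodular" is uminus
  unfolding quasimodular_functions_def by (rule uhp_fun.span_neg)

lift_definition times_quasimodular :: "quasimodular \<Rightarrow> quasimodular \<Rightarrow> quasimodular" is "(*)"
  by (rule quasimodular_functions_mult)

instance
  by standard (transfer; simp add: algebra_simps)+

end

lift_definition scaleQ :: "complex \<Rightarrow> quasimodular \<Rightarrow> quasimodular" (infixr "*\<^sub>Q" 75) is scale_fun
  unfolding quasimodular_functions_def by (rule uhp_fun.span_scale)

global_interpretation quasimodular: vector_space scaleQ
  by unfold_locales
    (transfer; auto simp: scale_fun_def fun_eq_iff algebra_simps)+

lemma eisenstein_monomialI:
  "eisenstein2 ^ i * eisenstein4 ^ j * eisenstein6 ^ l \<in> quasimodular_functions"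
  unfolding quasimodular_functions_def eisenstein_monomials_def
  by (rule uhp_fun.span_base) blast

lift_definition E2 :: quasimodular is eisenstein2
  using eisenstein_monomialI[of 1 0 0] by simp

lift_definition E4 :: quasimodular is eisenstein4
  using eisenstein_monomialI[of 0 1 0] by simp

lift_definition E6 :: quasimodular is eisenstein6
  using eisenstein_monomialI[of 0 0 1] by simp

definition Delta :: quasimodular where
  "Delta = E4 ^ 3 - E6 ^ 2"


section \<open>Weight and depth\<close>

text \<open>
  Weights of modular forms are integers, so that the weight \<open>k - 2 s\<close> below is not truncated;
  there are only zero forms of negative weight.
\<close>

definition modular_forms :: "int \<Rightarrow> quasimodular set" where
  "modular_forms k = quasimodular.span {E4 ^ i * E6 ^ j | i j. 4 * int i + 6 * int j = k}"

definition qm_exact :: "nat \<Rightarrow> nat \<Rightarrow> quasimodular set" where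
  "qm_exact k s = {f * E2 ^ s | f. f \<in> modular_forms (int k - 2 * int s)}"

definition qm_le :: "nat \<Rightarrow> nat \<Rightarrow> quasimodular set" where
  "qm_le k s = {(\<Sum>j\<le>s. h j) | h. \<forall>j\<le>s. h j \<in> qm_exact k j}"

text \<open>
  The value \<open>\<K>\<^sub>\<alpha>(f)\<close> for \<open>f\<close> of weight \<open>k\<close> and exact depth \<open>s\<close>, as a function of \<open>k\<close> and \<open>s\<close>.
\<close>

definition kappa :: "complex \<Rightarrow> nat \<Rightarrow> nat \<Rightarrow> complex" where
  "kappa \<alpha> k s = of_nat k - (3 * \<alpha> + 2) * of_nat s"


section \<open>Derivations, Poisson brackets and formal deformations\<close>

definition qm_linear :: "(quasimodular \<Rightarrow> quasimodular) \<Rightarrow> bool" where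
  "qm_linear D \<longleftrightarrow> Vector_Spaces.linear scaleQ scaleQ D"

definition qm_bilinear :: "(quasimodular \<Rightarrow> quasimodular \<Rightarrow> quasimodular) \<Rightarrow> bool" where
  "qm_bilinear B \<longleftrightarrow> (\<forall>f. qm_linear (\<lambda>g. B f g)) \<and> (\<forall>g. qm_linear (\<lambda>f. B f g))"

definition derivation :: "(quasimodular \<Rightarrow> quasimodular) \<Rightarrow> bool" where
  "derivation D \<longleftrightarrow> qm_linear D \<and> (\<forall>f g. D (f * g) = D f * g + f * D g)"

definition poisson_bracket :: "(quasimodular \<Rightarrow> quasimodular \<Rightarrow> quasimodular) \<Rightarrow> bool" where
  "poisson_bracket P \<longleftrightarrow>
     qm_bilinear P \<and>
     (\<forall>f. P f f = 0) \<and>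
     (\<forall>f g h. P f (P g h) + P g (P h f) + P h (P f g) = 0) \<and>
     (\<forall>f. derivation (P f))"

definition alpha_bracket :: "complex \<Rightarrow> (quasimodular \<Rightarrow> quasimodular \<Rightarrow> quasimodular) \<Rightarrow> bool" where
  "alpha_bracket \<alpha> P \<longleftrightarrow>
     poisson_bracket P \<and>
     P E4 E6 = (-2) *\<^sub>Q Delta \<and>
     P E2 E4 = \<alpha> *\<^sub>Q (E6 * E2) \<and>
     P E2 E6 = (3 / 2 * \<alpha>) *\<^sub>Q (E4 ^ 2 * E2)"

text \<open>The quotient \<open>P \<Delta> f / (12 \<Delta>)\<close>; the algebra is an integral domain, so it is unique.\<close>

definition v_derivation ::
    "(quasimodular \<Rightarrow> quasimodular \<Rightarrow> quasimodular) \<Rightarrow> quasimodular \<Rightarrow> quasimodular" where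
  "v_derivation P f = (THE g. 12 *\<^sub>Q (Delta * g) = P Delta f)"

definition complex_like :: "(quasimodular \<Rightarrow> quasimodular) \<Rightarrow> bool" where
  "complex_like D \<longleftrightarrow>
     derivation D \<and> (\<forall>k s. even k \<longrightarrow> D ` qm_le k s \<subseteq> qm_le (k + 2) (s + 1))"

definition pi_space :: "complex \<Rightarrow> (quasimodular \<Rightarrow> quasimodular) set" where
  "pi_space \<alpha> =
     {D. complex_like D \<and>
         (\<forall>k l s t. even k \<longrightarrow> even l \<longrightarrow> (\<forall>f \<in> qm_exact k s. \<forall>g \<in> qm_exact l t.
            kappa \<alpha> k s *\<^sub>Q (f * D g) - kappa \<alpha> l t *\<^sub>Q (g * D f) = 0))}"

definition generator_of_line ::
    "(quasimodular \<Rightarrow> quasimodular) \<Rightarrow> (quasimodular \<Rightarrow> quasimodular) set \<Rightarrow> bool" where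
  "generator_of_line D V \<longleftrightarrow> D \<noteq> (\<lambda>f. 0) \<and> V = {(\<lambda>f. c *\<^sub>Q D f) | c. True}"

definition delta_derivation ::
    "(quasimodular \<Rightarrow> quasimodular \<Rightarrow> quasimodular) \<Rightarrow> (quasimodular \<Rightarrow> quasimodular) \<Rightarrow> complex
       \<Rightarrow> quasimodular \<Rightarrow> quasimodular" where
  "delta_derivation P \<pi> b f = b *\<^sub>Q \<pi> f + v_derivation P f"

text \<open>
  \<open>\<mu>\<close> is the bilinear extension of the brackets prescribed on the components of exact depth.
  For \<open>D = b \<pi> + v\<close> the value \<open>\<alpha> = - 1 / 3\<close> is exceptional. There \<open>\<kappa>(E2) = 1\<close>, \<open>\<pi> f = c \<kappa>(f) f E2\<close>
  for a constant \<open>c\<close>, and \<open>v E2 = 0\<close>; when \<open>\<kappa>(f)\<close> is not an integer \<open>\<le> 0\<close>, the series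
  \<open>\<Sum>r. D\<^sup>r f t\<^sup>r / (r! \<kappa>(f) (\<kappa>(f) + 1) \<dots> (\<kappa>(f) + r - 1))\<close> equals \<open>exp (b c E2 t)\<close> times the same
  series for \<open>v\<close>. These factors cancel in the brackets, which therefore do not depend on \<open>b\<close>
  (for all \<open>\<kappa>(f)\<close>, by polynomiality).
\<close>

definition rankin_cohen_family ::
    "complex \<Rightarrow> (quasimodular \<Rightarrow> quasimodular)
       \<Rightarrow> (nat \<Rightarrow> quasimodular \<Rightarrow> quasimodular \<Rightarrow> quasimodular) \<Rightarrow> bool" where
  "rankin_cohen_family \<alpha> D \<mu> \<longleftrightarrow>
     (\<forall>n. qm_bilinear (\<mu> n)) \<and>
     (\<forall>n k l s t. even k \<longrightarrow> even l \<longrightarrow> (\<forall>f \<in> qm_exact k s. \<forall>g \<in> qm_exact l t.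
        \<mu> n f g =
          (\<Sum>r\<le>n. ((-1) ^ r
             * ((kappa \<alpha> k s + of_nat n - 1) gchoose (n - r))
             * ((kappa \<alpha> l t + of_nat n - 1) gchoose r))
             *\<^sub>Q ((D ^^ r) f * (D ^^ (n - r)) g))))"

definition formal_deformation :: "(nat \<Rightarrow> quasimodular \<Rightarrow> quasimodular \<Rightarrow> quasimodular) \<Rightarrow> bool" where
  "formal_deformation \<mu> \<longleftrightarrow>
     (\<forall>n. qm_bilinear (\<mu> n)) \<and>
     \<mu> 0 = (*) \<and>
     (\<forall>n f g h. (\<Sum>r\<le>n. \<mu> (n - r) (\<mu> r f g) h) = (\<Sum>r\<le>n. \<mu> (n - r) f (\<mu> r g h)))"

definition weight_depth_compatible ::
    "(nat \<Rightarrow> quasimodular \<Rightarrow> quasimodular \<Rightarrow> quasimodular) \<Rightarrow> bool" where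
  "weight_depth_compatible \<mu> \<longleftrightarrow>
     (\<forall>n k l s t. even k \<longrightarrow> even l \<longrightarrow> (\<forall>f \<in> qm_le k s. \<forall>g \<in> qm_le l t.
        \<mu> n f g \<in> qm_le (k + l + 2 * n) (s + t)))"

end

theory Submission
  imports Defs
begin

text \<open>
  Associativity comes from the Moyal product. A form \<open>f\<close> of weight \<open>k\<close> in an algebra with derivation
  \<open>D\<close> is encoded by the formal expansion \<open>F\<close> of the homogeneous function \<open>y\<^sup>-\<^sup>k f (x / y)\<close> at
  \<open>(0, 1)\<close>. The transvectants of \<open>F\<close> and \<open>G\<close>, powers of a Poisson bivector with constant
  coefficients, satisfy the associativity identities; since they commute with \<open>sl\<^sub>2\<close>, they are again
  encodings of forms, namely, up to the factor \<open>(- 1)\<^sup>n n!\<close>, of the Rankin-Cohen brackets.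

  On the algebra of quasimodular forms, \<open>v\<close> preserves the depth and annihilates \<open>E2\<close>, and every
  generator of the line of admissible derivations is \<open>\<pi> f = c \<kappa>(f) f E2\<close> with \<open>c \<noteq> 0\<close>. Its contribution
  cancels in the bracket of order 1. In \<open>[E4, E4]\<^sub>2\<close> it leaves \<open>- 80 (b c)\<^sup>2 (1 + 3 \<alpha>) E4\<^sup>2 E2\<^sup>2\<close>,
  which is not modular unless \<open>b = 0\<close> or \<open>\<alpha> = - 1 / 3\<close>. Algebraic independence of the Eisenstein series is
  never needed in full: the required instances follow from three coefficients of \<open>q\<close>-expansions.
\<close>

section \<open>Transvectants and Rankin-Cohen brackets\<close>

lemma sum_binomial_Suc:
  fixes a :: "nat \<Rightarrow> 'a::comm_ring_1"
  shows "(\<Sum>r\<le>Suc n. of_nat (Suc n choose r) * a r) =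
         (\<Sum>r\<le>n. of_nat (n choose r) * (a r + a (Suc r)))"
proof -
  have "(\<Sum>r\<le>Suc n. of_nat (Suc n choose r) * a r) =
      a 0 + (\<Sum>r\<le>n. of_nat (n choose r) * a (Suc r)) + (\<Sum>r\<le>n. of_nat (n choose Suc r) * a (Suc r))"
    by (subst sum.atMost_Suc_shift) (simp add: algebra_simps sum.distrib)
  also have "a 0 + (\<Sum>r\<le>n. of_nat (n choose Suc r) * a (Suc r)) = (\<Sum>r\<le>Suc n. of_nat (n choose r) * a r)"
    by (subst sum.atMost_Suc_shift) simp
  then have "a 0 + (\<Sum>r\<le>n. of_nat (n choose r) * a (Suc r)) + (\<Sum>r\<le>n. of_nat (n choose Suc r) * a (Suc r))
      = (\<Sum>r\<le>n. of_nat (n choose r) * a (Suc r)) + (\<Sum>r\<le>Suc n. of_nat (n choose r) * a r)"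
    by (simp add: algebra_simps)
  finally show ?thesis
    by (simp add: algebra_simps sum.distrib binomial_eq_0)
qed

text \<open>Multiplication after the n-th power of Y \<otimes> X - X \<otimes> Y, the classical
  transvectant when X and Y are partial derivatives. Each factor is peeled off on the arguments, so
  inductions keep F and G arbitrary.\<close>

primrec transvectant :: "('b \<Rightarrow> 'b) \<Rightarrow> ('b \<Rightarrow> 'b) \<Rightarrow> nat \<Rightarrow> 'b \<Rightarrow> 'b \<Rightarrow> 'b::comm_ring_1" where
  "transvectant X Y 0 F G = F * G"
| "transvectant X Y (Suc n) F G = transvectant X Y n (Y F) (X G) - transvectant X Y n (X F) (Y G)"

text \<open>Only additivity and the Leibniz rule are asked, so the notion makes sense on power
  series over any commutative ring, without a field of scalars.\<close>

definition ring_derivation :: "('b \<Rightarrow> 'b::comm_ring_1) \<Rightarrow> bool" where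
  "ring_derivation X \<longleftrightarrow> (\<forall>F G. X (F + G) = X F + X G) \<and> (\<forall>F G. X (F * G) = X F * G + F * X G)"

lemma
  assumes "ring_derivation X"
  shows ring_derivation_add: "X (F + G) = X F + X G"
    and ring_derivation_mult: "X (F * G) = X F * G + F * X G"
  using assms unfolding ring_derivation_def by auto

lemma
  assumes "ring_derivation X"
  shows ring_derivation_0: "X 0 = 0"
    and ring_derivation_1: "X 1 = 0"
    and ring_derivation_minus: "X (- F) = - X F"
    and ring_derivation_diff: "X (F - G) = X F - X G"
proof -
  note add = ring_derivation_add[OF assms] and mult = ring_derivation_mult[OF assms]
  show 0: "X 0 = 0"
    using add[of 0 0] by simp
  show "X 1 = 0"
    using mult[of 1 1] by simp
  show m: "X (- F) = - X F" for F
    using add[of F "- F"] 0 by (simp add: add_eq_0_iff)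
  show "X (F - G) = X F - X G"
    using add[of F "- G"] m by simp
qed

locale commuting_derivations =
  fixes X Y :: "'b \<Rightarrow> 'b::comm_ring_1"
  assumes X: "ring_derivation X" and Y: "ring_derivation Y"
    and commute: "X (Y F) = Y (X F)"
begin

lemmas derivation_simps =
  ring_derivation_add[OF X] ring_derivation_mult[OF X] ring_derivation_0[OF X]
  ring_derivation_minus[OF X] ring_derivation_diff[OF X]
  ring_derivation_add[OF Y] ring_derivation_mult[OF Y] ring_derivation_0[OF Y]
  ring_derivation_minus[OF Y] ring_derivation_diff[OF Y]

abbreviation U :: "nat \<Rightarrow> 'b \<Rightarrow> 'b \<Rightarrow> 'b" where
  "U \<equiv> transvectant X Y"

lemma transvectant_add_left: "U n (F + F') G = U n F G + U n F' G"
  by (induction n arbitrary: F F' G) (simp_all add: derivation_simps algebra_simps)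

lemma transvectant_add_right: "U n F (G + G') = U n F G + U n F G'"
  by (induction n arbitrary: F G G') (simp_all add: derivation_simps algebra_simps)

lemma transvectant_minus_left: "U n (- F) G = - U n F G"
  by (induction n arbitrary: F G) (simp_all add: derivation_simps algebra_simps)

lemma transvectant_minus_right: "U n F (- G) = - U n F G"
  by (induction n arbitrary: F G) (simp_all add: derivation_simps algebra_simps)

lemma transvectant_diff_left: "U n (F - F') G = U n F G - U n F' G"
  using transvectant_add_left[of n F "- F'" G] by (simp add: transvectant_minus_left)

lemma transvectant_diff_right: "U n F (G - G') = U n F G - U n F G'"
  using transvectant_add_right[of n F G "- G'"] by (simp add: transvectant_minus_right)

lemmas transvectant_linear =
  transvectant_add_left transvectant_add_right transvectant_minus_left transvectant_minus_right
  transvectant_diff_left transvectant_diff_right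

text \<open>X commutes with X and Y, hence with the bivector, and obeys the Leibniz rule on the
  final product.\<close>

lemma X_transvectant: "X (U n F G) = U n (X F) G + U n F (X G)"
  by (induction n arbitrary: F G) (simp_all add: derivation_simps commute algebra_simps)

lemma Y_transvectant: "Y (U n F G) = U n (Y F) G + U n F (Y G)"
  by (induction n arbitrary: F G) (simp_all add: derivation_simps commute algebra_simps)

text \<open>
  Both sides are the \<open>n\<close>-th power of the operator \<open>\<Pi>\<^sub>1\<^sub>2 + \<Pi>\<^sub>1\<^sub>3 + \<Pi>\<^sub>2\<^sub>3\<close>, where \<open>\<Pi> = Y \<otimes> X - X \<otimes> Y\<close>,
  followed by multiplication; the induction peels off one factor.
\<close>

lemma transvectant_assoc:
  "(\<Sum>r\<le>n. of_nat (n choose r) * U (n - r) (U r F G) H) =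
   (\<Sum>r\<le>n. of_nat (n choose r) * U (n - r) F (U r G H))"
proof (induction n arbitrary: F G H)
  case 0
  show ?case by (simp add: mult.assoc)
next
  case (Suc n)
  define L where "L F G H = (\<Sum>r\<le>n. of_nat (n choose r) * U (n - r) (U r F G) H)" for F G H
  define R where "R F G H = (\<Sum>r\<le>n. of_nat (n choose r) * U (n - r) F (U r G H))" for F G H
  have LR: "L F G H = R F G H" for F G H
    unfolding L_def R_def by (rule Suc.IH)
  have "(\<Sum>r\<le>Suc n. of_nat (Suc n choose r) * U (Suc n - r) (U r F G) H) =
      (\<Sum>r\<le>n. of_nat (n choose r) * (U (Suc (n - r)) (U r F G) H + U (n - r) (U (Suc r) F G) H))"
    by (subst sum_binomial_Suc) (intro sum.cong refl, simp add: Suc_diff_le)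
  \<comment> \<open>The outer factor meets a transvectant of F and G; the Leibniz rules turn it into
    \<Pi> on slots 1, 3 and on slots 2, 3. The inner factor is \<Pi> on slots 1, 2.\<close>
  also have "\<dots> = L (Y F) G (X H) + L F (Y G) (X H) - L (X F) G (Y H) - L F (X G) (Y H)
      + L (Y F) (X G) H - L (X F) (Y G) H"
    unfolding L_def
    by (simp add: X_transvectant Y_transvectant transvectant_linear sum.distrib sum_subtractf algebra_simps)
  also have "\<dots> = R (Y F) G (X H) + R F (Y G) (X H) - R (X F) G (Y H) - R F (X G) (Y H)
      + R (Y F) (X G) H - R (X F) (Y G) H"
    by (simp add: LR)
  also have "\<dots> =
      (\<Sum>r\<le>n. of_nat (n choose r) * (U (Suc (n - r)) F (U r G H) + U (n - r) F (U (Suc r) G H)))"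
    unfolding R_def
    by (simp add: X_transvectant Y_transvectant transvectant_linear sum.distrib sum_subtractf algebra_simps)
  also have "\<dots> = (\<Sum>r\<le>Suc n. of_nat (Suc n choose r) * U (Suc n - r) F (U r G H))"
    by (subst sum_binomial_Suc) (intro sum.cong refl, simp add: Suc_diff_le)
  finally show ?case .
qed

lemma Y_funpow_X: "Y ((X ^^ r) F) = (X ^^ r) (Y F)"
  by (induction r) (simp_all add: commute[symmetric])

text \<open>The binomial theorem for the difference of the commuting operators Y \<otimes> X and X
  \<otimes> Y.\<close>

lemma transvectant_eq_sum:
  "U n F G = (\<Sum>r\<le>n. of_nat (n choose r) *
     ((- 1) ^ r * ((Y ^^ (n - r)) ((X ^^ r) F) * (Y ^^ r) ((X ^^ (n - r)) G))))"
proof (induction n arbitrary: F G)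
  case 0
  show ?case by simp
next
  case (Suc n)
  have X_pow: "(X ^^ r) (X F) = (X ^^ Suc r) F" for r F
    by (simp add: funpow_swap1)
  have Y_pow: "(Y ^^ i) ((X ^^ r) (Y F)) = (Y ^^ Suc i) ((X ^^ r) F)" for i r F
    by (simp add: funpow_swap1 Y_funpow_X)
  show ?case
    unfolding transvectant.simps Suc.IH sum_binomial_Suc X_pow Y_pow sum_subtractf[symmetric]
    by (intro sum.cong refl) (simp add: Suc_diff_le algebra_simps)
qed

text \<open>\<open>E\<close> plays the role of the Euler field and \<open>M\<close> of a nilpotent element of \<open>sl\<^sub>2\<close>.\<close>

lemma Euler_transvectant:
  assumes E: "ring_derivation E"
    and EX: "\<And>F. E (X F) = X (E F) - X F" and EY: "\<And>F. E (Y F) = Y (E F) - Y F"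
    and "X k = 0" "Y k = 0" "X l = 0" "Y l = 0"
    and "E F = - (k * F)" "E G = - (l * G)"
  shows "E (U n F G) = - ((k + l + 2 * of_nat n) * U n F G)"
  using assms(4-)
proof (induction n arbitrary: F G k l)
  case 0
  then show ?case by (simp add: ring_derivation_mult[OF E] algebra_simps)
next
  case (Suc n)
  \<comment> \<open>Differentiation lowers the degree of homogeneity by one, so the induction
    hypothesis is used with k + 1 and l + 1, which must again be constants for X and Y.\<close>
  have const: "X (k + 1) = 0" "Y (k + 1) = 0" "X (l + 1) = 0" "Y (l + 1) = 0"
    using Suc.prems by (simp_all add: derivation_simps ring_derivation_1[OF X] ring_derivation_1[OF Y])
  have 1: "E (U n (Y F) (X G)) = - ((k + 1 + (l + 1) + 2 * of_nat n) * U n (Y F) (X G))"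
    using Suc.prems
    by (intro Suc.IH const) (simp_all add: EX EY derivation_simps algebra_simps)
  have 2: "E (U n (X F) (Y G)) = - ((k + 1 + (l + 1) + 2 * of_nat n) * U n (X F) (Y G))"
    using Suc.prems
    by (intro Suc.IH const) (simp_all add: EX EY derivation_simps algebra_simps)
  show ?case
    by (simp add: ring_derivation_diff[OF E] 1 2 algebra_simps)
qed

text \<open>Under M the field Y moves by - X and X is fixed, so Y \<otimes> X - X \<otimes> Y
  changes by - X \<otimes> X + X \<otimes> X = 0: the bivector is a determinant, invariant under
  unipotent substitutions.\<close>

lemma nilpotent_transvectant:
  assumes M: "ring_derivation M"
    and MX: "\<And>F. M (X F) = X (M F)" and MY: "\<And>F. M (Y F) = Y (M F) - X F"
  shows "M (U n F G) = U n (M F) G + U n F (M G)"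
proof (induction n arbitrary: F G)
  case 0
  show ?case by (simp add: ring_derivation_mult[OF M])
next
  case (Suc n)
  then show ?case
    by (simp add: ring_derivation_diff[OF M] MX MY transvectant_linear)
qed

end

section \<open>Derivations of formal power series in two variables\<close>

definition fps_lift :: "('a::zero \<Rightarrow> 'b::zero) \<Rightarrow> 'a fps \<Rightarrow> 'b fps" where
  "fps_lift h F = Abs_fps (\<lambda>n. h (fps_nth F n))"

lemma fps_lift_nth [simp]: "fps_nth (fps_lift h F) n = h (fps_nth F n)"
  by (simp add: fps_lift_def)

lemma ring_derivation_sum: "ring_derivation X \<Longrightarrow> X (\<Sum>i\<in>I. f i) = (\<Sum>i\<in>I. X (f i))"
  by (induction I rule: infinite_finite_induct) (simp_all add: ring_derivation_0 ring_derivation_add)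

lemma ring_derivation_fps_lift:
  assumes "ring_derivation h"
  shows "ring_derivation (fps_lift h)"
  unfolding ring_derivation_def
  by (auto simp: fps_eq_iff fps_mult_nth ring_derivation_sum[OF assms] ring_derivation_add[OF assms]
      ring_derivation_mult[OF assms] sum.distrib)

lemma ring_derivation_fps_deriv: "ring_derivation (fps_deriv :: 'a::comm_ring_1 fps \<Rightarrow> 'a fps)"
  by (simp add: ring_derivation_def algebra_simps)

lemma ring_derivation_mult_left: "ring_derivation X \<Longrightarrow> ring_derivation (\<lambda>F. c * X F)"
  by (simp add: ring_derivation_def algebra_simps)

lemma ring_derivation_plus:
  "ring_derivation X \<Longrightarrow> ring_derivation Y \<Longrightarrow> ring_derivation (\<lambda>F. X F + Y F)"
  by (simp add: ring_derivation_def algebra_simps)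

lemma ring_derivation_minus':
  "ring_derivation X \<Longrightarrow> ring_derivation Y \<Longrightarrow> ring_derivation (\<lambda>F. X F - Y F)"
  by (simp add: ring_derivation_def algebra_simps)

text \<open>In a series of series the inner variable is x and the outer one is y - 1, as expansions
  are taken at (0, 1).\<close>

abbreviation deriv_x :: "'a::comm_ring_1 fps fps \<Rightarrow> 'a fps fps" where
  "deriv_x \<equiv> fps_lift fps_deriv"

abbreviation deriv_y :: "'a::comm_ring_1 fps fps \<Rightarrow> 'a fps fps" where
  "deriv_y \<equiv> fps_deriv"

interpretation jets: commuting_derivations deriv_x deriv_y
  by unfold_locales
    (auto simp: ring_derivation_fps_lift ring_derivation_fps_deriv fps_eq_iff algebra_simps)

text \<open>Scalars enter as ring elements through the homomorphism \<open>emb\<close>, and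
  \<open>D\<close> treats them as constants. Characteristic 0 allows division by factorials. The
  instance used below is \<open>c *\<^sub>Q 1\<close>.\<close>

locale scalar_derivation =
  fixes emb :: "'k::field_char_0 \<Rightarrow> 'a::comm_ring_1" and D :: "'a \<Rightarrow> 'a"
  assumes emb_add: "emb (c + d) = emb c + emb d"
    and emb_mult: "emb (c * d) = emb c * emb d"
    and emb_1: "emb 1 = 1"
    and D: "ring_derivation D"
    and D_emb: "D (emb c) = 0"
begin

lemma emb_0: "emb 0 = 0"
  using emb_add[of 0 0] by simp

lemma emb_minus: "emb (- c) = - emb c"
  using emb_add[of c "- c"] emb_0 by (simp add: add_eq_0_iff)

lemma emb_of_nat: "emb (of_nat n) = of_nat n"
  by (induction n) (simp_all add: emb_0 emb_1 emb_add)

lemma emb_power: "emb (c ^ n) = emb c ^ n"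
  by (induction n) (simp_all add: emb_1 emb_mult)

lemma emb_sum: "emb (sum c I) = (\<Sum>i\<in>I. emb (c i))"
  by (induction I rule: infinite_finite_induct) (simp_all add: emb_0 emb_add)

text \<open>The weights are free scalars, not tied to a grading, because \<open>kappa\<close> takes
  complex values.\<close>

definition rankin_cohen :: "'k \<Rightarrow> 'k \<Rightarrow> nat \<Rightarrow> 'a \<Rightarrow> 'a \<Rightarrow> 'a" where
  "rankin_cohen k l n f g =
     (\<Sum>r\<le>n. emb ((- 1) ^ r * ((k + of_nat n - 1) gchoose (n - r)) * ((l + of_nat n - 1) gchoose r))
        * ((D ^^ r) f * (D ^^ (n - r)) g))"

text \<open>The outer \<open>fps_X\<close> is y - 1, so this is the field x d/dx + y d/dy.\<close>

definition Euler :: "'a fps fps \<Rightarrow> 'a fps fps" where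
  "Euler F = fps_const fps_X * deriv_x F + (1 + fps_X) * deriv_y F"

text \<open>The field y d/dx minus \<open>D\<close> on coefficients. It annihilates the expansion of
  y^(-k) f(x / y), where y d/dx replaces f by its derivative.\<close>

definition horizontal :: "'a fps fps \<Rightarrow> 'a fps fps" where
  "horizontal F = (1 + fps_X) * deriv_x F - fps_lift (fps_lift D) F"

text \<open>
  The Taylor expansion at \<open>(0, 1)\<close> of \<open>y powr (- k) * f (x / y)\<close>, where \<open>D\<close> is the derivative of \<open>f\<close>.
\<close>

definition jet :: "'k \<Rightarrow> 'a \<Rightarrow> 'a fps fps" where
  "jet k f = Abs_fps (\<lambda>b. Abs_fps (\<lambda>a.
     emb ((- 1) ^ b * pochhammer (k + of_nat a) b / (fact a * fact b)) * (D ^^ a) f))"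

abbreviation jet_const :: "'k \<Rightarrow> 'a fps fps" where
  "jet_const k \<equiv> fps_const (fps_const (emb k))"

abbreviation jet_value :: "'a fps fps \<Rightarrow> 'a" where
  "jet_value F \<equiv> fps_nth (fps_nth F 0) 0"

section \<open>Homogeneous horizontal series as encodings of forms\<close>

lemma ring_derivation_Euler: "ring_derivation Euler"
  unfolding Euler_def[abs_def]
  by (intro ring_derivation_plus ring_derivation_mult_left ring_derivation_fps_lift ring_derivation_fps_deriv)

lemma ring_derivation_horizontal: "ring_derivation horizontal"
  unfolding horizontal_def[abs_def]
  by (intro ring_derivation_minus' ring_derivation_mult_left ring_derivation_fps_lift
      ring_derivation_fps_deriv D)

lemma D_of_nat_mult: "D (of_nat n * a) = of_nat n * D a"
  using D_emb[of "of_nat n"] by (simp add: ring_derivation_mult[OF D] emb_of_nat)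

lemma deriv_x_const: "deriv_x (jet_const k) = 0" "deriv_y (jet_const k) = 0"
  by (simp_all add: fps_eq_iff)

lemma deriv_x_X: "deriv_x (fps_const fps_X) = 1" "deriv_x fps_X = 0" "deriv_x 1 = 0"
  by (simp_all add: fps_eq_iff fps_X_def fps_one_def)

lemma Euler_commute:
  "Euler (deriv_x F) = deriv_x (Euler F) - deriv_x F"
  "Euler (deriv_y F) = deriv_y (Euler F) - deriv_y F"
  unfolding Euler_def
  by (simp_all add: jets.derivation_simps deriv_x_X jets.commute algebra_simps)

text \<open>The commutator of y d/dx with d/dy is - d/dx, while \<open>D\<close> on coefficients
  commutes with both partial derivatives.\<close>

lemma horizontal_commute:
  "horizontal (deriv_x F) = deriv_x (horizontal F)"
  "horizontal (deriv_y F) = deriv_y (horizontal F) - deriv_x F"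
proof -
  have 1: "fps_lift (fps_lift D) (deriv_x F) = deriv_x (fps_lift (fps_lift D) F)"
    by (simp add: fps_eq_iff D_of_nat_mult flip: of_nat_Suc)
  have 2: "fps_lift (fps_lift D) (deriv_y F) = deriv_y (fps_lift (fps_lift D) F)"
    by (simp add: fps_eq_iff D_of_nat_mult fps_of_nat[symmetric] flip: of_nat_Suc)
  show "horizontal (deriv_x F) = deriv_x (horizontal F)"
    unfolding horizontal_def by (simp add: 1 jets.derivation_simps deriv_x_X)
  show "horizontal (deriv_y F) = deriv_y (horizontal F) - deriv_x F"
    unfolding horizontal_def by (simp add: 2 jets.derivation_simps jets.commute algebra_simps)
qed


text \<open>These two equations fix all derivatives at the base point in terms of the value there
  (\<open>jet_value_xy\<close>). Unlike an explicit formula for the coefficients, they pass to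
  transvectants.\<close>

definition modular_jet :: "'k \<Rightarrow> 'a fps fps \<Rightarrow> bool" where
  "modular_jet k F \<longleftrightarrow> Euler F = - (jet_const k * F) \<and> horizontal F = 0"

lemma D_emb_mult: "D (emb c * a) = emb c * D a"
  by (simp add: ring_derivation_mult[OF D] D_emb)

lemma of_nat_emb_mult: "of_nat n * (emb c * a) = emb (of_nat n * c) * a"
  by (simp add: emb_mult emb_of_nat mult.assoc)

lemma modular_jet_jet: "modular_jet k (jet k f)"
proof -
  define c where "c b a = (- 1) ^ b * pochhammer (k + of_nat a) b / (fact a * fact b)" for a b
  have jet_nth: "fps_nth (fps_nth (jet k f) b) a = emb (c b a) * (D ^^ a) f" for a b
    by (simp add: jet_def c_def)
  \<comment> \<open>Homogeneity on coefficients: (b + 1) c (b + 1) a = - (k + a + b) c b a, which is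
    the last factor of the rising factorial.\<close>
  have Euler_coeff: "of_nat a * c b a + (of_nat (Suc b) * c (Suc b) a + of_nat b * c b a) = - (k * c b a)" for a b
    by (simp add: c_def pochhammer_Suc divide_simps del: of_nat_Suc) (simp add: algebra_simps)
  have "fps_nth (fps_nth (Euler (jet k f)) b) a = fps_nth (fps_nth (- (jet_const k * jet k f)) b) a" for a b
  proof -
    have x: "fps_nth (fps_nth (fps_const fps_X * deriv_x (jet k f)) b) a = emb (of_nat a * c b a) * (D ^^ a) f"
      by (cases a) (simp_all add: jet_nth of_nat_emb_mult emb_0 del: of_nat_Suc)
    have y: "fps_nth (fps_nth ((1 + fps_X) * deriv_y (jet k f)) b) a =
        emb (of_nat (Suc b) * c (Suc b) a + of_nat b * c b a) * (D ^^ a) f"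
      by (cases b) (simp_all add: distrib_right jet_nth fps_of_nat[symmetric] of_nat_emb_mult emb_0 emb_add del: of_nat_Suc)
    have "fps_nth (fps_nth (Euler (jet k f)) b) a =
        emb (of_nat a * c b a + (of_nat (Suc b) * c (Suc b) a + of_nat b * c b a)) * (D ^^ a) f"
      unfolding Euler_def fps_add_nth x y emb_add by (simp add: algebra_simps)
    then show ?thesis
      unfolding Euler_coeff by (simp add: jet_nth emb_minus emb_mult mult.assoc)
  qed
  moreover have "fps_nth (fps_nth (horizontal (jet k f)) b) a = 0" for a b
  \<comment> \<open>The factor 1 + \<open>fps_X\<close> brings in the coefficient at index b - 1,
    which is absent for b = 0.\<close>
  proof (cases b)
    case 0
    then show ?thesis
      by (simp add: horizontal_def distrib_right jet_nth of_nat_emb_mult D_emb_mult c_def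
          divide_simps del: of_nat_Suc)
  next
    case (Suc b')
    have "of_nat (Suc a) * c (Suc b') (Suc a) + of_nat (Suc a) * c b' (Suc a) = c (Suc b') a"
    proof -
      \<comment> \<open>The first factor is split off one rising factorial and the last factor off
        the other, leaving a common part.\<close>
      have p: "pochhammer (k + of_nat a) (Suc b') = (k + of_nat a) * pochhammer (k + of_nat (Suc a)) b'"
        by (simp add: pochhammer_rec add_ac)
      have q: "pochhammer (k + of_nat (Suc a)) (Suc b') =
          pochhammer (k + of_nat (Suc a)) b' * (k + of_nat a + of_nat (Suc b'))"
        by (simp add: pochhammer_Suc algebra_simps)
      show ?thesis
        unfolding c_def p q by (simp add: divide_simps del: of_nat_Suc) (simp add: algebra_simps)
    qed
    moreover have "fps_nth (fps_nth ((1 + fps_X) * deriv_x (jet k f)) (Suc b')) a =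
        emb (of_nat (Suc a) * c (Suc b') (Suc a) + of_nat (Suc a) * c b' (Suc a)) * (D ^^ Suc a) f"
      by (simp add: distrib_right jet_nth of_nat_emb_mult emb_add del: of_nat_Suc)
    ultimately show ?thesis
      using Suc by (simp add: horizontal_def jet_nth D_emb_mult)
  qed
  ultimately show ?thesis
    by (simp add: modular_jet_def fps_eq_iff)
qed

lemma jet_value_jet: "jet_value (jet k f) = f"
  by (simp add: jet_def emb_1)

text \<open>The sl2-equivariance of transvectants. It makes iterated transvectants accessible
  through their values, with the weight that the outer bracket requires.\<close>

lemma modular_jet_transvectant:
  assumes F: "modular_jet k F" and G: "modular_jet l G"
  shows "modular_jet (k + l + 2 * of_nat n) (jets.U n F G)"
proof -
  have c: "jet_const (k + l + 2 * of_nat n) = jet_const k + jet_const l + 2 * of_nat n"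
    by (simp add: emb_add emb_mult emb_of_nat fps_of_nat[symmetric] emb_of_nat[of 2, simplified])
  have "Euler (jets.U n F G) = - ((jet_const k + jet_const l + 2 * of_nat n) * jets.U n F G)"
    using F G unfolding modular_jet_def
    by (intro jets.Euler_transvectant ring_derivation_Euler Euler_commute deriv_x_const) auto
  moreover have "horizontal (jets.U n F G) = jets.U n (horizontal F) G + jets.U n F (horizontal G)"
    by (intro jets.nilpotent_transvectant ring_derivation_horizontal horizontal_commute)
  moreover have "jets.U n 0 G = 0" "jets.U n F 0 = 0"
    using jets.transvectant_diff_left[of n 0 0 G] jets.transvectant_diff_right[of n F 0 0] by auto
  ultimately show ?thesis
    using F G unfolding modular_jet_def c by simp
qed

text \<open>At the base point y = 1, so horizontality there says that d/dx acts as \<open>D\<close>.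
  The weight grows by one because the degree of homogeneity drops by one.\<close>

lemma modular_jet_x:
  assumes "modular_jet k F"
  shows "modular_jet (k + 1) (deriv_x F)" and "jet_value (deriv_x F) = D (jet_value F)"
proof -
  have "fps_nth (fps_nth (horizontal F) 0) 0 = 0"
    using assms by (simp add: modular_jet_def)
  then show "jet_value (deriv_x F) = D (jet_value F)"
    by (simp add: horizontal_def distrib_right)
  have "Euler (deriv_x F) = deriv_x (- (jet_const k * F)) - deriv_x F"
    using assms by (simp add: modular_jet_def Euler_commute)
  also have "\<dots> = - ((jet_const k + 1) * deriv_x F)"
    by (simp only: jets.derivation_simps deriv_x_const) (simp add: algebra_simps)
  also have "jet_const k + 1 = jet_const (k + 1)"
    by (simp add: emb_add emb_1)
  finally show "modular_jet (k + 1) (deriv_x F)"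
    using assms by (simp add: modular_jet_def horizontal_commute jets.derivation_simps)
qed

lemma modular_jet_x_funpow:
  assumes "modular_jet k F"
  shows "modular_jet (k + of_nat a) ((deriv_x ^^ a) F) \<and> jet_value ((deriv_x ^^ a) F) = (D ^^ a) (jet_value F)"
proof (induction a)
  case 0
  then show ?case using assms by simp
next
  case (Suc a)
  then show ?case
    using modular_jet_x[of "k + of_nat a" "(deriv_x ^^ a) F"] by (simp add: add_ac del: fps_lift_nth)
qed

text \<open>At (0, 1) the Euler field is d/dy, so each y-derivative multiplies the value by the
  current degree: - k, - k - 1, and so on.\<close>

lemma jet_value_y_funpow:
  assumes "Euler F = - (jet_const k * F)"
  shows "Euler ((deriv_y ^^ b) F) = - (jet_const (k + of_nat b) * (deriv_y ^^ b) F) \<and>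
    jet_value ((deriv_y ^^ b) F) = emb ((- 1) ^ b * pochhammer k b) * jet_value F"
proof (induction b)
  case 0
  then show ?case using assms by (simp add: emb_1)
next
  case (Suc b)
  define G where "G = (deriv_y ^^ b) F"
  have G: "Euler G = - (jet_const (k + of_nat b) * G)"
    "jet_value G = emb ((- 1) ^ b * pochhammer k b) * jet_value F"
    using Suc.IH by (auto simp: G_def)
  have "jet_value (Euler G) = jet_value (deriv_y G)"
    by (simp add: Euler_def distrib_right)
  then have v: "jet_value (deriv_y G) = emb ((- 1) ^ Suc b * pochhammer k (Suc b)) * jet_value F"
    unfolding G(1) by (simp add: G(2) pochhammer_Suc emb_mult emb_minus mult_ac)
  have "Euler (deriv_y G) = deriv_y (- (jet_const (k + of_nat b) * G)) - deriv_y G"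
    by (simp add: Euler_commute G(1))
  also have "\<dots> = - ((jet_const (k + of_nat b) + 1) * deriv_y G)"
    by (simp only: jets.derivation_simps deriv_x_const) (simp add: algebra_simps)
  also have "jet_const (k + of_nat b) + 1 = jet_const (k + of_nat (Suc b))"
    by (simp add: emb_add emb_1 add_ac)
  finally show ?case
    using v by (simp add: G_def)
qed

lemma jet_value_xy:
  assumes "modular_jet k F"
  shows "jet_value ((deriv_y ^^ b) ((deriv_x ^^ a) F)) =
    emb ((- 1) ^ b * pochhammer (k + of_nat a) b) * (D ^^ a) (jet_value F)"
  using modular_jet_x_funpow[OF assms, of a] jet_value_y_funpow[of "(deriv_x ^^ a) F" "k + of_nat a" b]
  by (simp add: modular_jet_def)

lemma jet_value_mult: "jet_value (F * G) = jet_value F * jet_value G"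
  by simp

lemma jet_value_sum: "jet_value (\<Sum>i\<in>I. F i) = (\<Sum>i\<in>I. jet_value (F i))"
  by (simp add: fps_sum_nth)

lemma jet_value_of_nat: "jet_value (of_nat n) = of_nat n"
  by (simp add: fps_of_nat[symmetric])

text \<open>Translates the binomials of the bracket into the rising factorials that jets
  produce.\<close>

lemma gbinomial_pochhammer_shift:
  assumes "r \<le> n"
  shows "(k + of_nat n - 1) gchoose (n - r) = pochhammer (k + of_nat r) (n - r) / (fact (n - r) :: 'k)"
  using assms by (simp add: gbinomial_pochhammer' of_nat_diff algebra_simps)

text \<open>Evaluates \<open>transvectant_eq_sum\<close> at the base point. Each mixed derivative is
  a rising factorial times a power of \<open>D\<close>, the signs combine to (-1)^n (-1)^r, and n
  choose r contributes n! over the two factorials in the binomials.\<close>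

lemma jet_value_transvectant:
  assumes F: "modular_jet k F" and G: "modular_jet l G"
  shows "jet_value (jets.U n F G) =
    emb ((- 1) ^ n * fact n) * rankin_cohen k l n (jet_value F) (jet_value G)"
proof -
  have "jet_value (jets.U n F G) = (\<Sum>r\<le>n. of_nat (n choose r) * ((- 1) ^ r *
      (emb ((- 1) ^ (n - r) * pochhammer (k + of_nat r) (n - r)) * (D ^^ r) (jet_value F) *
       (emb ((- 1) ^ r * pochhammer (l + of_nat (n - r)) r) * (D ^^ (n - r)) (jet_value G)))))"
    unfolding jets.transvectant_eq_sum jet_value_sum jet_value_mult jet_value_of_nat
      jet_value_xy[OF F] jet_value_xy[OF G]
    by (intro sum.cong refl) (simp add: fps_nth_power_0)
  also have "\<dots> = (\<Sum>r\<le>n. emb ((- 1) ^ n * fact n) *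
      (emb ((- 1) ^ r * ((k + of_nat n - 1) gchoose (n - r)) * ((l + of_nat n - 1) gchoose r))
        * ((D ^^ r) (jet_value F) * (D ^^ (n - r)) (jet_value G))))"
  proof (intro sum.cong refl)
    fix r assume "r \<in> {..n}"
    then have r: "r \<le> n" by simp
    have l: "(l + of_nat n - 1) gchoose r = pochhammer (l + of_nat (n - r)) r / fact r"
      using gbinomial_pochhammer_shift[of "n - r" n l] r by simp
    have sign: "(- 1) ^ r * ((- 1) ^ (n - r) * (- 1) ^ r) = (- 1) ^ n * (- 1 :: 'k) ^ r"
      using r by (simp add: add.commute flip: power_add)
    have "of_nat (n choose r) * ((- 1) ^ r * ((- 1) ^ (n - r) * pochhammer (k + of_nat r) (n - r) *
          ((- 1) ^ r * pochhammer (l + of_nat (n - r)) r))) =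
        ((- 1) ^ r * ((- 1) ^ (n - r) * (- 1) ^ r)) * (of_nat (n choose r) *
           (pochhammer (k + of_nat r) (n - r) * pochhammer (l + of_nat (n - r)) r))"
      by (simp only: mult_ac)
    also have "\<dots> = (- 1) ^ n * fact n *
        ((- 1) ^ r * ((k + of_nat n - 1) gchoose (n - r)) * ((l + of_nat n - 1) gchoose r))"
      unfolding sign l gbinomial_pochhammer_shift[OF r] using r by (simp add: binomial_fact field_simps)
    finally have *: "emb (of_nat (n choose r) * ((- 1) ^ r * ((- 1) ^ (n - r) *
          pochhammer (k + of_nat r) (n - r) * ((- 1) ^ r * pochhammer (l + of_nat (n - r)) r)))) =
        emb ((- 1) ^ n * fact n *
        ((- 1) ^ r * ((k + of_nat n - 1) gchoose (n - r)) * ((l + of_nat n - 1) gchoose r)))"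
      by (rule arg_cong)
    show "of_nat (n choose r) * ((- 1) ^ r *
        (emb ((- 1) ^ (n - r) * pochhammer (k + of_nat r) (n - r)) * (D ^^ r) (jet_value F) *
         (emb ((- 1) ^ r * pochhammer (l + of_nat (n - r)) r) * (D ^^ (n - r)) (jet_value G)))) =
      emb ((- 1) ^ n * fact n) *
        (emb ((- 1) ^ r * ((k + of_nat n - 1) gchoose (n - r)) * ((l + of_nat n - 1) gchoose r))
        * ((D ^^ r) (jet_value F) * (D ^^ (n - r)) (jet_value G)))"
      using arg_cong[OF *, of "\<lambda>c. c * ((D ^^ r) (jet_value F) * (D ^^ (n - r)) (jet_value G))"]
      unfolding emb_mult emb_of_nat emb_power emb_minus emb_1 by (simp only: mult_ac)
  qed
  finally show ?thesis
    by (simp add: rankin_cohen_def sum_distrib_left)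
qed

text \<open>Both sides, up to one common constant, are values of the two sides of
  \<open>transvectant_assoc\<close> for the jets of f, g and h. The inner transvectant is again a
  modular jet, which produces the shifted weights.\<close>

theorem rankin_cohen_assoc:
  "(\<Sum>r\<le>n. rankin_cohen (k + l + 2 * of_nat r) m (n - r) (rankin_cohen k l r f g) h) =
   (\<Sum>r\<le>n. rankin_cohen k (l + m + 2 * of_nat r) (n - r) f (rankin_cohen l m r g h))"
proof -
  define F G H where "F = jet k f" and "G = jet l g" and "H = jet m h"
  have jets: "modular_jet k F" "modular_jet l G" "modular_jet m H"
    unfolding F_def G_def H_def by (rule modular_jet_jet)+
  have vals: "jet_value F = f" "jet_value G = g" "jet_value H = h"
    unfolding F_def G_def H_def by (rule jet_value_jet)+
  have scale: "rankin_cohen k' l' n' (emb c * f') g' = emb c * rankin_cohen k' l' n' f' g'"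
    "rankin_cohen k' l' n' f' (emb c * g') = emb c * rankin_cohen k' l' n' f' g'" for k' l' n' c f' g'
  proof -
    have "(D ^^ i) (emb c * a) = emb c * (D ^^ i) a" for i a
      by (induction i) (simp_all add: D_emb_mult)
    then show "rankin_cohen k' l' n' (emb c * f') g' = emb c * rankin_cohen k' l' n' f' g'"
      "rankin_cohen k' l' n' f' (emb c * g') = emb c * rankin_cohen k' l' n' f' g'"
      by (simp_all add: rankin_cohen_def sum_distrib_left mult_ac)
  qed
  \<comment> \<open>The binomial weight merges (n - r)! and r! into n!, so that the constant does
    not depend on r.\<close>
  have coeff: "of_nat (n choose r) * (emb ((- 1) ^ (n - r) * fact (n - r)) * (emb ((- 1) ^ r * fact r) * a)) =
      emb ((- 1) ^ n * fact n) * a" if "r \<le> n" for r a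
  proof -
    have "of_nat (n choose r) * (((- 1) ^ (n - r) * fact (n - r)) * ((- 1) ^ r * fact r)) =
        ((- 1) ^ (n - r) * (- 1) ^ r) * (of_nat (n choose r) * fact (n - r) * (fact r :: 'k))"
      by (simp only: mult_ac)
    also have "(- 1) ^ (n - r) * (- 1) ^ r = (- 1 :: 'k) ^ n"
      using that by (simp flip: power_add)
    also have "of_nat (n choose r) * fact (n - r) * (fact r :: 'k) = fact n"
      using that by (simp add: binomial_fact)
    finally have "emb (of_nat (n choose r) * (((- 1) ^ (n - r) * fact (n - r)) * ((- 1) ^ r * fact r))) =
        emb ((- 1) ^ n * fact n)" by simp
    from arg_cong[OF this, of "\<lambda>c. c * a"] show ?thesis
      unfolding emb_mult emb_of_nat by (simp only: mult.assoc)
  qed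
  have "emb ((- 1) ^ n * fact n) *
      (\<Sum>r\<le>n. rankin_cohen (k + l + 2 * of_nat r) m (n - r) (rankin_cohen k l r f g) h) =
      jet_value (\<Sum>r\<le>n. of_nat (n choose r) * jets.U (n - r) (jets.U r F G) H)"
    unfolding jet_value_sum jet_value_mult jet_value_of_nat sum_distrib_left
    by (intro sum.cong refl)
      (simp only: jet_value_transvectant[OF modular_jet_transvectant jets(3), OF jets(1,2)]
        jet_value_transvectant[OF jets(1,2)] vals scale coeff atMost_iff)
  also have "\<dots> = jet_value (\<Sum>r\<le>n. of_nat (n choose r) * jets.U (n - r) F (jets.U r G H))"
    by (simp only: jets.transvectant_assoc)
  also have "\<dots> = emb ((- 1) ^ n * fact n) *
      (\<Sum>r\<le>n. rankin_cohen k (l + m + 2 * of_nat r) (n - r) f (rankin_cohen l m r g h))"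
    unfolding jet_value_sum jet_value_mult jet_value_of_nat sum_distrib_left
    by (intro sum.cong refl)
      (simp only: jet_value_transvectant[OF jets(1) modular_jet_transvectant, OF jets(2,3)]
        jet_value_transvectant[OF jets(2,3)] vals scale coeff atMost_iff)
  \<comment> \<open>The constant is a nonzero scalar, so it is cancelled by multiplying with the
    image of its inverse; the ring itself may have zero divisors.\<close>
  finally have "emb (1 / ((- 1) ^ n * fact n)) * (emb ((- 1) ^ n * fact n) *
      (\<Sum>r\<le>n. rankin_cohen (k + l + 2 * of_nat r) m (n - r) (rankin_cohen k l r f g) h)) =
      emb (1 / ((- 1) ^ n * fact n)) * (emb ((- 1) ^ n * fact n) *
      (\<Sum>r\<le>n. rankin_cohen k (l + m + 2 * of_nat r) (n - r) f (rankin_cohen l m r g h)))"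
    by simp
  moreover have "emb (1 / ((- 1) ^ n * fact n)) * (emb ((- 1) ^ n * fact n) * a) = a" for a
    unfolding mult.assoc[symmetric] emb_mult[symmetric] by (simp add: emb_1)
  ultimately show ?thesis
    by simp
qed


section \<open>Brackets under a twist of the derivation\<close>

text \<open>
  The derivatives of \<open>f\<close> under an operator that acts on weight \<open>w\<close> as \<open>D + w e\<close>, where \<open>e\<close> has
  weight \<open>1\<close> and \<open>D e = 0\<close>.
\<close>

definition twist :: "'a \<Rightarrow> 'k \<Rightarrow> 'a \<Rightarrow> nat \<Rightarrow> 'a" where
  "twist e k f r =
     (\<Sum>i\<le>r. emb (of_nat (r choose i) * pochhammer (k + of_nat i) (r - i)) * (e ^ (r - i) * (D ^^ i) f))"

text \<open>The products e^p D^i f form a family on which T acts as prescribed, with weight k + 2 i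
  + p: each \<open>D\<close> adds 2 and each e adds 1. The coefficients of the powers of T then obey
  a Pascal-type recursion.\<close>

lemma funpow_eq_twist:
  assumes add: "\<And>a b. T (a + b) = T a + T b" and scale: "\<And>c a. T (emb c * a) = emb c * T a"
    and step: "\<And>p i. T (e ^ p * (D ^^ i) f) =
      e ^ p * (D ^^ Suc i) f + emb (k + 2 * of_nat i + of_nat p) * (e ^ Suc p * (D ^^ i) f)"
  shows "(T ^^ r) f = twist e k f r"
proof (induction r)
  case 0
  show ?case by (simp add: twist_def emb_1)
next
  case (Suc r)
  have T0: "T 0 = 0"
    using add[of 0 0] by simp
  have T_sum: "T (sum a I) = (\<Sum>i\<in>I. T (a i))" for a :: "nat \<Rightarrow> 'a" and I
    by (induction I rule: infinite_finite_induct) (simp_all add: T0 add)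
  define c where "c r i = of_nat (r choose i) * pochhammer (k + of_nat i) (r - i)" for r i
  define c' where "c' i = (case i of 0 \<Rightarrow> 0 | Suc i' \<Rightarrow> c r i')" for i
  define M where "M i = e ^ (Suc r - i) * (D ^^ i) f" for i
  \<comment> \<open>\<open>c' i\<close> comes from applying \<open>D\<close> to the term i - 1; the
    other summand comes from multiplying the term i, of weight k + 2 i + (r - i) = k + r + i, by
    e.\<close>
  have coeff: "c' i + c r i * (k + of_nat r + of_nat i) = c (Suc r) i" if "i \<le> Suc r" for i
  proof (cases i)
    case 0
    then show ?thesis by (simp add: c_def c'_def pochhammer_Suc)
  next
    case (Suc i')
    show ?thesis
    proof (cases "i = Suc r")
      case True
      then show ?thesis by (simp add: c_def c'_def)
    next
      case False
      then have i': "r - i' = Suc (r - i)" "i' < r" using that Suc by auto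
      define p where "p = pochhammer (k + of_nat i) (r - i)"
      have 1: "pochhammer (k + of_nat i') (r - i') = (k + of_nat i') * p"
        unfolding i'(1) pochhammer_rec by (simp add: p_def Suc add_ac)
      have 2: "pochhammer (k + of_nat i) (Suc r - i) = p * (k + of_nat r)"
        using that False by (simp add: p_def Suc_diff_le pochhammer_Suc of_nat_diff)
      have "Suc i' * (r choose Suc i') = (r - i') * (r choose i')"
        by (rule binomial_absorb_comp[symmetric, THEN trans[OF binomial_absorption]])
      \<comment> \<open>The absorption identity to which the recursion reduces once the common
        rising factorial p is taken out.\<close>
      then have 3: "of_nat i * of_nat (r choose i) = (of_nat r - of_nat i') * (of_nat (r choose i') :: 'k)"
        using i' Suc by (metis of_nat_diff of_nat_mult less_imp_le)
      have 4: "(of_nat (Suc r choose i) :: 'k) = of_nat (r choose i') + of_nat (r choose i)"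
        by (simp add: Suc)
      have "c' i + c r i * (k + of_nat r + of_nat i) - c (Suc r) i =
          p * (of_nat i * of_nat (r choose i) - (of_nat r - of_nat i') * of_nat (r choose i'))"
        unfolding c_def 2 4 p_def[symmetric] c'_def using Suc by (simp add: 1 algebra_simps)
      then show ?thesis
        by (simp add: 3)
    qed
  qed
  have "(T ^^ Suc r) f = (\<Sum>i\<le>r. emb (c r i) * (M (Suc i) + emb (k + of_nat r + of_nat i) * M i))"
    unfolding funpow.simps o_apply Suc.IH twist_def T_sum scale step c_def
  proof (intro sum.cong refl)
    fix i assume "i \<in> {..r}"
    then have "Suc (r - i) = Suc r - i" "k + 2 * of_nat i + of_nat (r - i) = k + of_nat r + of_nat i"
      by (simp_all add: of_nat_diff)
    then show "emb (of_nat (r choose i) * pochhammer (k + of_nat i) (r - i)) *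
        (e ^ (r - i) * D ((D ^^ i) f) +
         emb (k + 2 * of_nat i + of_nat (r - i)) * (e ^ Suc (r - i) * (D ^^ i) f)) =
      emb (of_nat (r choose i) * pochhammer (k + of_nat i) (r - i)) *
        (M (Suc i) + emb (k + of_nat r + of_nat i) * M i)"
      by (simp only: M_def diff_Suc_Suc funpow.simps o_apply)
  qed
  also have "\<dots> = (\<Sum>i\<le>r. emb (c r i) * M (Suc i)) + (\<Sum>i\<le>r. emb (c r i * (k + of_nat r + of_nat i)) * M i)"
    by (simp only: distrib_left[of "emb _"] sum.distrib emb_mult mult.assoc)
  also have "(\<Sum>i\<le>r. emb (c r i) * M (Suc i)) = (\<Sum>i\<le>Suc r. emb (c' i) * M i)"
    by (subst sum.atMost_Suc_shift) (simp add: c'_def emb_0)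
  also have "(\<Sum>i\<le>r. emb (c r i * (k + of_nat r + of_nat i)) * M i) =
      (\<Sum>i\<le>Suc r. emb (c r i * (k + of_nat r + of_nat i)) * M i)"
    by (simp add: c_def emb_0 binomial_eq_0)
  also have "(\<Sum>i\<le>Suc r. emb (c' i) * M i) + (\<Sum>i\<le>Suc r. emb (c r i * (k + of_nat r + of_nat i)) * M i) =
      (\<Sum>i\<le>Suc r. emb (c (Suc r) i) * M i)"
    unfolding sum.distrib[symmetric] distrib_right[symmetric] emb_add[symmetric]
    by (intro sum.cong refl) (simp add: coeff)
  also have "\<dots> = twist e k f (Suc r)"
    by (simp add: twist_def c_def M_def)
  finally show ?case .
qed

text \<open>With m = n - i - j and r = i + p, this is the alternating binomial sum of order m
  divided by m!, which vanishes unless m = 0. The conditions encode the ranges of summation, so that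
  sums can be exchanged later.\<close>

lemma alternating_fact_sum:
  "(\<Sum>r\<le>n. if i \<le> r \<and> j \<le> n - r then (- 1) ^ r / (fact (r - i) * fact (n - r - j)) else 0) =
   (if i + j = n then (- 1) ^ i else 0 :: 'k)"
proof (cases "i + j \<le> n")
  case False
  then show ?thesis by (auto intro!: sum.neutral)
next
  case True
  define m where "m = n - i - j"
  have "(\<Sum>r\<le>n. if i \<le> r \<and> j \<le> n - r then (- 1) ^ r / (fact (r - i) * fact (n - r - j)) else 0) =
      (\<Sum>r\<in>{i..n - j}. (- 1) ^ r / (fact (r - i) * fact (n - r - j)) :: 'k)"
    using True by (intro sum.mono_neutral_cong_right) auto
  also have "\<dots> = (\<Sum>p\<le>m. (- 1) ^ (p + i) / (fact p * fact (m - p)))"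
    using True by (intro sum.reindex_bij_witness[of _ "\<lambda>p. p + i" "\<lambda>r. r - i"]) (auto simp: m_def diff_diff_left add_ac)
  also have "\<dots> = (\<Sum>p\<le>m. (- 1) ^ i / fact m * ((- 1) ^ p * of_nat (m choose p)))"
    by (intro sum.cong refl) (simp add: binomial_fact power_add)
  also have "\<dots> = (- 1) ^ i / fact m * (\<Sum>p\<le>m. (- 1) ^ p * of_nat (m choose p))"
    by (simp add: sum_distrib_left)
  also have "\<dots> = (if i + j = n then (- 1) ^ i else 0)"
    using True choose_alternating_sum[of m, where 'a = 'k] by (cases "m = 0") (auto simp: m_def)
  finally show ?thesis .
qed

text \<open>Expanding both twists, the terms containing D^i f and D^j g share the power e^(n - i -
  j), and their total coefficient is an alternating sum that vanishes unless i + j = n. What remains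
  is free of e.\<close>

lemma rankin_cohen_twist:
  "(\<Sum>r\<le>n. emb ((- 1) ^ r * ((k + of_nat n - 1) gchoose (n - r)) * ((l + of_nat n - 1) gchoose r))
        * (twist e k f r * twist e l g (n - r))) = rankin_cohen k l n f g"
proof -
  define C where "C r = (- 1) ^ r * ((k + of_nat n - 1) gchoose (n - r)) * ((l + of_nat n - 1) gchoose r)" for r
  define a where "a i = emb (pochhammer (k + of_nat i) (n - i) / fact i) * (D ^^ i) f" for i
  define b where "b j = emb (pochhammer (l + of_nat j) (n - j) / fact j) * (D ^^ j) g" for j
  define s where "s r i j = (if i \<le> r \<and> j \<le> n - r then (- 1) ^ r / (fact (r - i) * fact (n - r - j)) else 0 :: 'k)" for r i j
  \<comment> \<open>The rising factorial of length n - i splits at r into the part in the twist and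
    the part in the bracket; likewise for j. All dependence on r is then in
    \<open>s r i j\<close>.\<close>
  have summand: "emb (C r) * (emb (of_nat (r choose i) * pochhammer (k + of_nat i) (r - i)) * (e ^ (r - i) * (D ^^ i) f)
      * (emb (of_nat ((n - r) choose j) * pochhammer (l + of_nat j) (n - r - j)) * (e ^ (n - r - j) * (D ^^ j) g)))
      = emb (s r i j) * (e ^ (n - i - j) * (a i * b j))"
    if le: "r \<le> n" "i \<le> r" "j \<le> n - r" for r i j
  proof -
    have p: "pochhammer (k + of_nat i) (n - i) = pochhammer (k + of_nat i) (r - i) * pochhammer (k + of_nat r) (n - r)"
      using pochhammer_product'[of "k + of_nat i" "r - i" "n - r"] le by (simp add: of_nat_diff)
    have q: "pochhammer (l + of_nat j) (n - j) = pochhammer (l + of_nat j) (n - r - j) * pochhammer (l + of_nat (n - r)) r"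
      using pochhammer_product'[of "l + of_nat j" "n - r - j" r] le by (simp add: of_nat_diff)
    have Cr: "C r = (- 1) ^ r * (pochhammer (k + of_nat r) (n - r) / fact (n - r)) * (pochhammer (l + of_nat (n - r)) r / fact r)"
      using gbinomial_pochhammer_shift[of r n k] gbinomial_pochhammer_shift[of "n - r" n l] le by (simp add: C_def)
    have "C r * ((of_nat (r choose i) * pochhammer (k + of_nat i) (r - i)) *
        (of_nat ((n - r) choose j) * pochhammer (l + of_nat j) (n - r - j))) =
        s r i j * ((pochhammer (k + of_nat i) (n - i) / fact i) * (pochhammer (l + of_nat j) (n - j) / fact j))"
      unfolding Cr p q using le by (simp add: s_def binomial_fact mult_ac)
    then have coeff: "emb (C r) * (emb (of_nat (r choose i) * pochhammer (k + of_nat i) (r - i)) *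
        emb (of_nat ((n - r) choose j) * pochhammer (l + of_nat j) (n - r - j))) =
        emb (s r i j) * (emb (pochhammer (k + of_nat i) (n - i) / fact i) * emb (pochhammer (l + of_nat j) (n - j) / fact j))"
      unfolding emb_mult[symmetric] by (rule arg_cong)
    have "e ^ (n - i - j) = e ^ (r - i) * e ^ (n - r - j)"
      using le by (simp flip: power_add)
    with arg_cong[OF coeff, of "\<lambda>c. c * (e ^ (n - i - j) * ((D ^^ i) f * (D ^^ j) g))"] show ?thesis
      unfolding a_def b_def by (simp only: mult_ac)
  qed
  have "(\<Sum>r\<le>n. emb (C r) * (twist e k f r * twist e l g (n - r))) =
      (\<Sum>r\<le>n. \<Sum>i\<le>r. \<Sum>j\<le>n - r. emb (s r i j) * (e ^ (n - i - j) * (a i * b j)))"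
    unfolding twist_def unfolding sum_product unfolding sum_distrib_left
    by (intro sum.cong refl) (simp only: summand atMost_iff)
  \<comment> \<open>All ranges are extended to n, where \<open>s\<close> vanishes on the new terms,
    so that the summation over r can be moved innermost.\<close>
  also have "\<dots> = (\<Sum>r\<le>n. \<Sum>i\<le>n. \<Sum>j\<le>n. emb (s r i j) * (e ^ (n - i - j) * (a i * b j)))"
  proof (rule sum.cong[OF refl])
    fix r assume r: "r \<in> {..n}"
    have "(\<Sum>j\<le>n - r. emb (s r i j) * (e ^ (n - i - j) * (a i * b j))) =
        (\<Sum>j\<le>n. emb (s r i j) * (e ^ (n - i - j) * (a i * b j)))" for i
      by (intro sum.mono_neutral_left) (auto simp: s_def emb_0)
    then show "(\<Sum>i\<le>r. \<Sum>j\<le>n - r. emb (s r i j) * (e ^ (n - i - j) * (a i * b j))) =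
        (\<Sum>i\<le>n. \<Sum>j\<le>n. emb (s r i j) * (e ^ (n - i - j) * (a i * b j)))"
      using r by (simp) (intro sum.mono_neutral_left, auto simp: s_def emb_0)
  qed
  also have "\<dots> = (\<Sum>i\<le>n. \<Sum>r\<le>n. \<Sum>j\<le>n. emb (s r i j) * (e ^ (n - i - j) * (a i * b j)))"
    by (rule sum.swap)
  also have "\<dots> = (\<Sum>i\<le>n. \<Sum>j\<le>n. \<Sum>r\<le>n. emb (s r i j) * (e ^ (n - i - j) * (a i * b j)))"
    by (rule sum.cong[OF refl]) (rule sum.swap)
  also have "\<dots> = (\<Sum>i\<le>n. \<Sum>j\<le>n. emb (if i + j = n then (- 1) ^ i else 0) * (e ^ (n - i - j) * (a i * b j)))"
    unfolding alternating_fact_sum[symmetric] s_def emb_sum sum_distrib_right ..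
  also have "\<dots> = (\<Sum>i\<le>n. emb ((- 1) ^ i) * (a i * b (n - i)))"
  proof (intro sum.cong refl)
    fix i assume i: "i \<in> {..n}"
    have "(\<Sum>j\<le>n. emb (if i + j = n then (- 1) ^ i else 0) * (e ^ (n - i - j) * (a i * b j))) =
        (\<Sum>j\<in>{n - i}. emb (if i + j = n then (- 1) ^ i else 0) * (e ^ (n - i - j) * (a i * b j)))"
      using i by (intro sum.mono_neutral_right) (auto simp: emb_0)
    then show "(\<Sum>j\<le>n. emb (if i + j = n then (- 1) ^ i else 0) * (e ^ (n - i - j) * (a i * b j))) =
        emb ((- 1) ^ i) * (a i * b (n - i))"
      using i by simp
  qed
  also have "\<dots> = rankin_cohen k l n f g"
    unfolding rankin_cohen_def
  proof (intro sum.cong refl)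
    fix i assume "i \<in> {..n}"
    then have "(- 1) ^ i * ((k + of_nat n - 1) gchoose (n - i)) * ((l + of_nat n - 1) gchoose i) =
        (- 1) ^ i * ((pochhammer (k + of_nat i) (n - i) / fact i) *
          (pochhammer (l + of_nat (n - i)) (n - (n - i)) / fact (n - i)))"
      using gbinomial_pochhammer_shift[of i n k] gbinomial_pochhammer_shift[of "n - i" n l] by (simp add: mult_ac)
    then show "emb ((- 1) ^ i) * (a i * b (n - i)) =
        emb ((- 1) ^ i * ((k + of_nat n - 1) gchoose (n - i)) * ((l + of_nat n - 1) gchoose i)) *
          ((D ^^ i) f * (D ^^ (n - i)) g)"
      unfolding a_def b_def by (simp only: emb_mult mult_ac)
  qed
  finally show ?thesis
    by (simp only: C_def)
qed

end


section \<open>Expansions at the cusp\<close>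

lemma norm_nome: "norm (nome z) < 1"
  using uhp_point[of z] by (simp add: nome_def)

lemma nome_surj:
  assumes "q \<noteq> 0" "norm q < 1"
  obtains z where "nome z = q"
proof -
  define w where "w = Ln q / (2 * of_real pi * \<i>)"
  have "Im w = - ln (norm q) / (2 * pi)"
    using assms by (simp add: w_def Im_divide power2_eq_square)
  also have "\<dots> > 0"
    using assms by (simp add: divide_neg_pos)
  finally have "uhp_point (Abs_uhp w) = w"
    by (simp add: Abs_uhp_inverse)
  then have "nome (Abs_uhp w) = q"
    using assms by (simp add: nome_def w_def)
  then show ?thesis
    by (rule that)
qed

definition has_q_expansion :: "(upper_half_plane \<Rightarrow> complex) \<Rightarrow> complex fps \<Rightarrow> bool" where
  "has_q_expansion f F \<longleftrightarrow> fps_conv_radius F \<ge> 1 \<and> (\<forall>z. f z = eval_fps F (nome z))"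

lemma norm_nome_less:
  assumes "fps_conv_radius F \<ge> 1"
  shows "ereal (norm (nome z)) < fps_conv_radius F"
  using norm_nome[of z] assms by (simp add: less_le_trans[of _ "1 :: ereal"])

lemma has_q_expansion_add:
  assumes "has_q_expansion f F" "has_q_expansion g G"
  shows "has_q_expansion (f + g) (F + G)"
  using assms order_trans[OF min.boundedI fps_conv_radius_add, of 1 F G] unfolding has_q_expansion_def
  by (auto simp: eval_fps_add norm_nome_less)

lemma has_q_expansion_mult:
  assumes "has_q_expansion f F" "has_q_expansion g G"
  shows "has_q_expansion (f * g) (F * G)"
  using assms order_trans[OF min.boundedI fps_conv_radius_mult, of 1 F G] unfolding has_q_expansion_def
  by (auto simp: eval_fps_mult norm_nome_less)

lemma has_q_expansion_const: "has_q_expansion (\<lambda>_. c) (fps_const c)"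
  by (simp add: has_q_expansion_def)

lemma has_q_expansion_scale:
  assumes "has_q_expansion f F"
  shows "has_q_expansion (scale_fun c f) (fps_const c * F)"
proof -
  have "scale_fun c f = (\<lambda>_. c) * f"
    by (auto simp: scale_fun_def)
  then show ?thesis
    using has_q_expansion_mult[OF has_q_expansion_const assms] by metis
qed

lemma has_q_expansion_one: "has_q_expansion 1 1"
  using has_q_expansion_const[of 1] by (simp add: one_fun_def)

lemma has_q_expansion_zero: "has_q_expansion 0 0"
  using has_q_expansion_const[of 0] by (simp add: zero_fun_def)

lemma has_q_expansion_power: "has_q_expansion f F \<Longrightarrow> has_q_expansion (f ^ n) (F ^ n)"
  by (induction n) (simp_all add: has_q_expansion_one has_q_expansion_mult)

lemma has_q_expansion_unique:
  assumes "has_q_expansion f F" "has_q_expansion f G"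
  shows "F = G"
proof -
  have rad: "fps_conv_radius F \<ge> 1" "fps_conv_radius G \<ge> 1"
    using assms by (auto simp: has_q_expansion_def)
  have eq: "eval_fps F q = eval_fps G q" if "q \<noteq> 0" "norm q < 1" for q
    using assms nome_surj[OF that] unfolding has_q_expansion_def by metis
  \<comment> \<open>The nome omits 0, so the series are known to agree only on the punctured disc.
    Multiplied by \<open>fps_X\<close> they agree at 0 too, and the identity theorem
    applies.\<close>
  have "fps_X * F = fps_X * G"
  proof (rule eval_fps_eqD)
    have "fps_conv_radius (fps_X * F) \<ge> 1" "fps_conv_radius (fps_X * G) \<ge> 1"
      using fps_conv_radius_mult[of fps_X F] fps_conv_radius_mult[of fps_X G] rad
      by (auto intro: order_trans)
    then show "fps_conv_radius (fps_X * F) > 0" "fps_conv_radius (fps_X * G) > 0"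
      by (auto intro: less_le_trans[of _ 1])
    have "eval_fps (fps_X * F) q = eval_fps (fps_X * G) q" if "q \<in> ball 0 1" for q
    proof -
      have "ereal (norm q) < fps_conv_radius F" "ereal (norm q) < fps_conv_radius G"
        using that rad by (auto intro: less_le_trans[of _ 1])
      then have "eval_fps (fps_X * F) q = q * eval_fps F q" "eval_fps (fps_X * G) q = q * eval_fps G q"
        by (simp_all add: eval_fps_mult)
      then show ?thesis
        using eq[of q] that by (cases "q = 0") auto
    qed
    then show "eventually (\<lambda>q. eval_fps (fps_X * F) q = eval_fps (fps_X * G) q) (nhds 0)"
      using eventually_nhds_in_open[of "ball 0 1" "0 :: complex"] by (auto elim: eventually_mono)
  qed
  then show ?thesis
    by simp
qed

section \<open>The q-expansions of Eisenstein series and of quasimodular forms\<close>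

definition sigma_fps :: "nat \<Rightarrow> complex fps" where
  "sigma_fps k = Abs_fps (\<lambda>n. of_nat (divisor_sigma k n))"

lemma divisor_sigma_le: "divisor_sigma k n \<le> n ^ Suc k"
proof (cases "n = 0")
  case False
  have "divisor_sigma k n \<le> (\<Sum>d | d dvd n. n ^ k)"
    unfolding divisor_sigma_def
    using False by (intro sum_mono power_mono) (auto dest: dvd_imp_le)
  also have "\<dots> = card {d. d dvd n} * n ^ k"
    by simp
  also have "card {d. d dvd n} \<le> card {1..n}"
    using False by (intro card_mono) (auto dest: dvd_imp_le intro: Suc_leI dvd_pos_nat)
  finally show ?thesis by simp
\<comment> \<open>Every number divides 0, and a sum over an infinite set is 0.\<close>
qed (simp add: divisor_sigma_def)

text \<open>Comparison with the series of n^(k + 1) x^n, whose radius is 1 by the ratio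
  test.\<close>

lemma fps_conv_radius_sigma: "fps_conv_radius (sigma_fps k) \<ge> 1"
proof -
  have lim: "(\<lambda>n. (real n / real (Suc n)) ^ Suc k) \<longlonglongrightarrow> 1 ^ Suc k"
    by (intro tendsto_power LIMSEQ_n_over_Suc_n)
  have "conv_radius (\<lambda>n. of_nat n ^ Suc k :: complex) = ereal 1"
    by (rule conv_radius_ratio_limit_nonzero[OF refl])
      (use lim in \<open>simp_all add: norm_power norm_divide power_divide del: power_Suc of_nat_Suc\<close>)
  then have *: "summable (\<lambda>n. norm (of_nat n ^ Suc k * x ^ n))" if "norm x < 1" for x :: complex
    using that by (intro abs_summable_in_conv_radius) auto
  have "summable (\<lambda>n. of_nat (divisor_sigma k n) * x ^ n)" if "norm x < 1" for x :: complex
  proof (rule summable_comparison_test'[OF *[OF that]])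
    fix n
    have "real (divisor_sigma k n) \<le> real n ^ Suc k"
      using divisor_sigma_le[of k n] by (metis of_nat_le_iff of_nat_power)
    then show "norm (of_nat (divisor_sigma k n) * x ^ n) \<le> norm (of_nat n ^ Suc k * x ^ n)"
      by (simp add: norm_mult norm_power mult_right_mono del: power_Suc)
  qed
  then show ?thesis
    using le_conv_radius_iff[of 1 "fps_nth (sigma_fps k)" 0]
    by (simp add: fps_conv_radius_def sigma_fps_def one_ereal_def)
qed

lemma has_q_expansion_sigma: "has_q_expansion (sigma_series k) (sigma_fps k)"
proof -
  have "sigma_series k z = eval_fps (sigma_fps k) (nome z)" for z
  proof -
    have "summable (\<lambda>n. fps_nth (sigma_fps k) n * nome z ^ n)"
      by (intro summable_fps norm_nome_less fps_conv_radius_sigma)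
    \<comment> \<open>The term of index 0 is split off; its coefficient is the empty convention
      \<open>divisor_sigma k 0 = 0\<close>.\<close>
    from suminf_split_head[OF this] show ?thesis
      by (simp add: sigma_series_def eval_fps_def sigma_fps_def divisor_sigma_def)
  qed
  then show ?thesis
    by (simp add: has_q_expansion_def fps_conv_radius_sigma)
qed

lemma has_q_expansion_affine:
  "has_q_expansion (\<lambda>z. 1 + c * sigma_series k z) (1 + fps_const c * sigma_fps k)"
proof -
  have "(\<lambda>z. 1 + c * sigma_series k z) = 1 + scale_fun c (sigma_series k)"
    by (auto simp: scale_fun_def)
  then show ?thesis
    using has_q_expansion_add[OF has_q_expansion_one has_q_expansion_scale[OF has_q_expansion_sigma]]
    by metis
qed

lemma has_q_expansion_eisenstein2: "has_q_expansion eisenstein2 (1 + fps_const (- 24) * sigma_fps 1)"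
  using has_q_expansion_affine[of "- 24" 1] by (simp add: eisenstein2_def[abs_def])

lemma has_q_expansion_eisenstein4: "has_q_expansion eisenstein4 (1 + fps_const 240 * sigma_fps 3)"
  using has_q_expansion_affine[of 240 3] by (simp add: eisenstein4_def[abs_def])

lemma has_q_expansion_eisenstein6: "has_q_expansion eisenstein6 (1 + fps_const (- 504) * sigma_fps 5)"
  using has_q_expansion_affine[of "- 504" 5] by (simp add: eisenstein6_def[abs_def])

lemma ex_q_expansion: "f \<in> quasimodular_functions \<Longrightarrow> \<exists>F. has_q_expansion f F"
  unfolding quasimodular_functions_def
proof (induction rule: uhp_fun.span_induct_alt)
  case base
  show ?case using has_q_expansion_zero by blast
next
  case (step c x y)
  then obtain i j l G where "x = eisenstein2 ^ i * eisenstein4 ^ j * eisenstein6 ^ l" "has_q_expansion y G"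
    unfolding eisenstein_monomials_def by blast
  then show ?case
    using has_q_expansion_eisenstein2 has_q_expansion_eisenstein4 has_q_expansion_eisenstein6
    by (blast intro: has_q_expansion_add has_q_expansion_scale has_q_expansion_mult has_q_expansion_power)
qed

definition q_expansion :: "quasimodular \<Rightarrow> complex fps" where
  "q_expansion f = (THE F. has_q_expansion (quasimodular_fun f) F)"

lemma has_q_expansion: "has_q_expansion (quasimodular_fun f) (q_expansion f)"
  unfolding q_expansion_def
  using ex_q_expansion[OF quasimodular_fun[of f]] has_q_expansion_unique by (metis theI')

lemma q_expansion_eqI: "has_q_expansion (quasimodular_fun f) F \<Longrightarrow> q_expansion f = F"
  by (rule has_q_expansion_unique[OF has_q_expansion])

lemma q_expansion_add: "q_expansion (f + g) = q_expansion f + q_expansion g"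
  by (intro q_expansion_eqI) (simp add: plus_quasimodular.rep_eq has_q_expansion_add has_q_expansion)

lemma q_expansion_mult: "q_expansion (f * g) = q_expansion f * q_expansion g"
  by (intro q_expansion_eqI) (simp add: times_quasimodular.rep_eq has_q_expansion_mult has_q_expansion)

lemma q_expansion_scale: "q_expansion (c *\<^sub>Q f) = fps_const c * q_expansion f"
  by (intro q_expansion_eqI) (simp add: scaleQ.rep_eq has_q_expansion_scale has_q_expansion)

lemma q_expansion_0: "q_expansion 0 = 0"
  by (intro q_expansion_eqI) (simp add: zero_quasimodular.rep_eq has_q_expansion_zero)

lemma q_expansion_eq_0_iff: "q_expansion f = 0 \<longleftrightarrow> f = 0"
proof
  assume "q_expansion f = 0"
  then have "has_q_expansion (quasimodular_fun f) 0"
    using has_q_expansion[of f] by simp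
  then have "quasimodular_fun f = quasimodular_fun 0"
    by (auto simp: has_q_expansion_def zero_quasimodular.rep_eq)
  then show "f = 0"
    by (simp add: quasimodular_fun_inject)
qed (simp add: q_expansion_0)

text \<open>The q-expansion embeds the algebra into formal power series over a field, which have no
  zero divisors.\<close>

instance quasimodular :: idom
proof
  fix f g :: quasimodular
  assume "f \<noteq> 0" "g \<noteq> 0"
  then show "f * g \<noteq> 0"
    by (simp add: q_expansion_mult flip: q_expansion_eq_0_iff)
qed

lemma q_expansion_E2: "q_expansion E2 = 1 + fps_const (- 24) * sigma_fps 1"
  by (intro q_expansion_eqI) (unfold E2.rep_eq, rule has_q_expansion_eisenstein2)

lemma q_expansion_E4: "q_expansion E4 = 1 + fps_const 240 * sigma_fps 3"
  by (intro q_expansion_eqI) (unfold E4.rep_eq, rule has_q_expansion_eisenstein4)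

lemma q_expansion_E6: "q_expansion E6 = 1 + fps_const (- 504) * sigma_fps 5"
  by (intro q_expansion_eqI) (unfold E6.rep_eq, rule has_q_expansion_eisenstein6)

section \<open>Linear independence in weight 12\<close>

definition coeffs012 :: "quasimodular \<Rightarrow> complex \<times> complex \<times> complex" where
  "coeffs012 f = (fps_nth (q_expansion f) 0, fps_nth (q_expansion f) 1, fps_nth (q_expansion f) 2)"

lemma divisor_sigma_small:
  "divisor_sigma k 0 = 0" "divisor_sigma k 1 = 1" "divisor_sigma k 2 = 1 + 2 ^ k"
proof -
  show "divisor_sigma k 0 = 0" "divisor_sigma k 1 = 1"
    by (simp_all add: divisor_sigma_def)
  have "d dvd 2 \<longleftrightarrow> d = 1 \<or> d = 2" for d :: nat
    using dvd_imp_le[of d 2] by (cases "d = 0") (auto simp: le_Suc_eq numeral_2_eq_2)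
  then have "{d :: nat. d dvd 2} = {1, 2}"
    by auto
  then show "divisor_sigma k 2 = 1 + 2 ^ k"
    by (simp add: divisor_sigma_def)
qed

lemma coeffs012_eisenstein:
  "coeffs012 E2 = (1, - 24, - 72)" "coeffs012 E4 = (1, 240, 2160)" "coeffs012 E6 = (1, - 504, - 16632)"
  by (simp_all add: coeffs012_def q_expansion_E2 q_expansion_E4 q_expansion_E6 sigma_fps_def
      divisor_sigma_small[unfolded One_nat_def])

lemma coeffs012_mult:
  assumes "coeffs012 f = (a, b, c)" "coeffs012 g = (a', b', c')"
  shows "coeffs012 (f * g) = (a * a', a * b' + b * a', a * c' + b * b' + c * a')"
  using assms by (auto simp: coeffs012_def q_expansion_mult fps_mult_nth numeral_2_eq_2)

text \<open>Three coefficients of the expansions give three equations for the three unknown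
  scalars.\<close>

lemma coeffs012_relation:
  assumes "coeffs012 f = (a, b, c)" "coeffs012 g = (a', b', c')" "coeffs012 h = (a'', b'', c'')"
    and "x *\<^sub>Q f + y *\<^sub>Q g + z *\<^sub>Q h = 0"
  shows "x * a + y * a' + z * a'' = 0" "x * b + y * b' + z * b'' = 0" "x * c + y * c' + z * c'' = 0"
proof -
  have "fps_nth (q_expansion (x *\<^sub>Q f + y *\<^sub>Q g + z *\<^sub>Q h)) n = 0" for n
    by (simp add: assms(4) q_expansion_0)
  from this[of 0] this[of 1] this[of 2] show
    "x * a + y * a' + z * a'' = 0" "x * b + y * b' + z * b'' = 0" "x * c + y * c' + z * c'' = 0"
    using assms(1-3) by (auto simp: coeffs012_def q_expansion_add q_expansion_scale)
qed

lemma coeffs012_weight12: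
  "coeffs012 (E4 ^ 3) = (1, 720, 179280)" "coeffs012 (E6 ^ 2) = (1, - 1008, 220752)"
  "coeffs012 (E4 * (E6 * E2)) = (1, - 288, - 129168)" "coeffs012 (E4 ^ 2 * E2 ^ 2) = (1, 432, 39312)"
proof -
  have E4_2: "coeffs012 (E4 * E4) = (1, 480, 61920)"
    by (rule coeffs012_mult[OF coeffs012_eisenstein(2,2), THEN trans]) simp
  have E2_2: "coeffs012 (E2 * E2) = (1, - 48, 432)"
    by (rule coeffs012_mult[OF coeffs012_eisenstein(1,1), THEN trans]) simp
  have E6_E2: "coeffs012 (E6 * E2) = (1, - 528, - 4608)"
    by (rule coeffs012_mult[OF coeffs012_eisenstein(3,1), THEN trans]) simp
  show "coeffs012 (E4 ^ 3) = (1, 720, 179280)" unfolding power3_eq_cube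
    by (rule coeffs012_mult[OF E4_2 coeffs012_eisenstein(2), THEN trans]) simp
  show "coeffs012 (E6 ^ 2) = (1, - 1008, 220752)" unfolding power2_eq_square
    by (rule coeffs012_mult[OF coeffs012_eisenstein(3,3), THEN trans]) simp
  show "coeffs012 (E4 * (E6 * E2)) = (1, - 288, - 129168)"
    by (rule coeffs012_mult[OF coeffs012_eisenstein(2) E6_E2, THEN trans]) simp
  show "coeffs012 (E4 ^ 2 * E2 ^ 2) = (1, 432, 39312)" unfolding power2_eq_square
    by (rule coeffs012_mult[OF E4_2 E2_2, THEN trans]) simp
qed

text \<open>The 3 by 3 matrix of coefficients is invertible. This relation arises when \<pi> E4 and
  \<pi> E6 are compared.\<close>

lemma E6_square_independent:
  assumes "x *\<^sub>Q E4 ^ 3 + y *\<^sub>Q (E4 * (E6 * E2)) + z *\<^sub>Q E6 ^ 2 = 0"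
  shows "z = 0"
  using coeffs012_relation[OF coeffs012_weight12(1,3,2) assms] by algebra

text \<open>Again an invertible matrix; it shows that E4^2 E2^2 is not a modular form of weight
  12.\<close>

lemma E4_E2_square_independent:
  assumes "x *\<^sub>Q E4 ^ 3 + y *\<^sub>Q E6 ^ 2 + z *\<^sub>Q (E4 ^ 2 * E2 ^ 2) = 0"
  shows "z = 0"
  using coeffs012_relation[OF coeffs012_weight12(1,2,4) assms] by algebra

lemma E4_nonzero: "E4 \<noteq> 0"
  using coeffs012_eisenstein by (auto simp: coeffs012_def q_expansion_0)


section \<open>The derivation of the Poisson bracket\<close>

lemma scaleQ_mult_left: "(c *\<^sub>Q f) * g = c *\<^sub>Q (f * g)"
  by transfer (auto simp: scale_fun_def fun_eq_iff)

lemma scaleQ_mult_right: "f * (c *\<^sub>Q g) = c *\<^sub>Q (f * g)"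
  by transfer (auto simp: scale_fun_def fun_eq_iff)

lemmas scaleQ_simps = scaleQ_mult_left scaleQ_mult_right quasimodular.scale_right_distrib
  quasimodular.scale_right_diff_distrib quasimodular.scale_minus_right

lemma quasimodular_eq_iff: "f = g \<longleftrightarrow> (\<forall>z. quasimodular_fun f z = quasimodular_fun g z)"
  by (auto simp: fun_eq_iff simp flip: quasimodular_fun_inject)

lemma quasimodular_fun_simps:
  "quasimodular_fun (f + g) z = quasimodular_fun f z + quasimodular_fun g z"
  "quasimodular_fun (f - g) z = quasimodular_fun f z - quasimodular_fun g z"
  "quasimodular_fun (- f) z = - quasimodular_fun f z"
  "quasimodular_fun (f * g) z = quasimodular_fun f z * quasimodular_fun g z"
  "quasimodular_fun (c *\<^sub>Q f) z = c * quasimodular_fun f z"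
  "quasimodular_fun 0 z = 0"
  "quasimodular_fun 1 z = 1"
  by (simp_all add: plus_quasimodular.rep_eq minus_quasimodular.rep_eq uminus_quasimodular.rep_eq
      times_quasimodular.rep_eq scaleQ.rep_eq scale_fun_def zero_quasimodular.rep_eq one_quasimodular.rep_eq)

lemma quasimodular_fun_power: "quasimodular_fun (f ^ n) z = quasimodular_fun f z ^ n"
  by (induction n) (simp_all add: quasimodular_fun_simps)

lemma quasimodular_fun_of_nat: "quasimodular_fun (of_nat n) z = of_nat n"
  by (induction n) (simp_all add: quasimodular_fun_simps)

lemma quasimodular_fun_numeral: "quasimodular_fun (numeral n) z = numeral n"
  using quasimodular_fun_of_nat[of "numeral n" z] by simp

text \<open>Reduces identities that mix ring operations and scalar multiplication to identities
  between complex numbers, where field arithmetic decides.\<close>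

lemmas quasimodular_pointwise =
  quasimodular_eq_iff quasimodular_fun_simps quasimodular_fun_power quasimodular_fun_of_nat
  quasimodular_fun_numeral

text \<open>Carries the span that defines the type from functions into the type, so that inductions
  over Eisenstein monomials can take place there.\<close>

lemma quasimodular_span_monomials:
  "quasimodular.span {E2 ^ i * E4 ^ j * E6 ^ l | i j l. True} = UNIV" (is "quasimodular.span ?S = _")
proof -
  have "\<exists>f. quasimodular_fun f = g \<and> f \<in> quasimodular.span ?S" if "g \<in> quasimodular_functions" for g
    using that unfolding quasimodular_functions_def
  proof (induction rule: uhp_fun.span_induct_alt)
    case base
    show ?case
      by (rule exI[of _ 0]) (simp add: zero_quasimodular.rep_eq quasimodular.span_zero)
  next
    case (step c x y)
    then obtain i j l f where x: "x = eisenstein2 ^ i * eisenstein4 ^ j * eisenstein6 ^ l"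
      and f: "quasimodular_fun f = y" "f \<in> quasimodular.span ?S"
      unfolding eisenstein_monomials_def by blast
    have "quasimodular_fun (g ^ n) = quasimodular_fun g ^ n" for g n
      by (induction n) (simp_all add: one_quasimodular.rep_eq times_quasimodular.rep_eq)
    then have "quasimodular_fun (c *\<^sub>Q (E2 ^ i * E4 ^ j * E6 ^ l) + f) = scale_fun c x + y"
      by (simp add: x f plus_quasimodular.rep_eq scaleQ.rep_eq times_quasimodular.rep_eq
          E2.rep_eq E4.rep_eq E6.rep_eq)
    moreover have "c *\<^sub>Q (E2 ^ i * E4 ^ j * E6 ^ l) + f \<in> quasimodular.span ?S"
      by (intro quasimodular.span_add quasimodular.span_scale f(2)) (rule quasimodular.span_base, blast)
    ultimately show ?case by blast
  qed
  from this[OF quasimodular_fun] have "f \<in> quasimodular.span ?S" for f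
    unfolding quasimodular_fun_inject by simp
  then show ?thesis
    by blast
qed

section \<open>Spaces of given weight and depth\<close>

lemma modular_forms_subspace: "quasimodular.subspace (modular_forms k)"
  unfolding modular_forms_def by (rule quasimodular.subspace_span)

lemma modular_forms_monomial: "4 * int i + 6 * int j = k \<Longrightarrow> E4 ^ i * E6 ^ j \<in> modular_forms k"
  unfolding modular_forms_def by (rule quasimodular.span_base) blast

lemma modular_forms_induct [consumes 1, case_names zero step]:
  assumes "f \<in> modular_forms k" "Q 0"
    and "\<And>c i j g. 4 * int i + 6 * int j = k \<Longrightarrow> Q g \<Longrightarrow> Q (c *\<^sub>Q (E4 ^ i * E6 ^ j) + g)"
  shows "Q f"
  using assms(1) unfolding modular_forms_def
  by (induction rule: quasimodular.span_induct_alt) (use assms(2,3) in auto)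

lemma modular_forms_mult:
  assumes "f \<in> modular_forms k" "g \<in> modular_forms l"
  shows "f * g \<in> modular_forms (k + l)"
  using assms(1)
proof (induction rule: modular_forms_induct)
  case zero
  show ?case by (simp add: quasimodular.subspace_0 modular_forms_subspace)
next
  case (step c i j f)
  have "E4 ^ i * E6 ^ j * g \<in> modular_forms (k + l)"
    using assms(2)
  proof (induction rule: modular_forms_induct)
    case zero
    show ?case by (simp add: quasimodular.subspace_0 modular_forms_subspace)
  next
    case (step c' i' j' g)
    have "E4 ^ i * E6 ^ j * (c' *\<^sub>Q (E4 ^ i' * E6 ^ j') + g) =
        c' *\<^sub>Q (E4 ^ (i + i') * E6 ^ (j + j')) + E4 ^ i * E6 ^ j * g"
      by (simp add: distrib_left scaleQ_simps power_add mult_ac)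
    moreover have "E4 ^ (i + i') * E6 ^ (j + j') \<in> modular_forms (k + l)"
      using step \<open>4 * int i + 6 * int j = k\<close> by (intro modular_forms_monomial) simp
    ultimately show ?case
      using step by (simp add: modular_forms_subspace quasimodular.subspace_add quasimodular.subspace_scale)
  qed
  then show ?case
    using step
    by (simp add: distrib_right scaleQ_simps modular_forms_subspace quasimodular.subspace_add
        quasimodular.subspace_scale)
qed

lemma qm_exactI: "f \<in> modular_forms (int k - 2 * int s) \<Longrightarrow> f * E2 ^ s \<in> qm_exact k s"
  unfolding qm_exact_def by blast

lemma qm_exactE:
  assumes "f \<in> qm_exact k s"
  obtains g where "g \<in> modular_forms (int k - 2 * int s)" "f = g * E2 ^ s"
  using assms unfolding qm_exact_def by blast

lemma qm_exact_subspace: "quasimodular.subspace (qm_exact k s)"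
proof (rule quasimodular.subspaceI)
  show "0 \<in> qm_exact k s"
    using qm_exactI[OF quasimodular.subspace_0[OF modular_forms_subspace]] by simp
next
  fix f g assume "f \<in> qm_exact k s" "g \<in> qm_exact k s"
  then show "f + g \<in> qm_exact k s"
    by (auto elim!: qm_exactE simp flip: distrib_right
        intro!: qm_exactI quasimodular.subspace_add[OF modular_forms_subspace])
next
  fix c f assume "f \<in> qm_exact k s"
  then show "c *\<^sub>Q f \<in> qm_exact k s"
    by (auto elim!: qm_exactE simp flip: scaleQ_mult_left
        intro!: qm_exactI quasimodular.subspace_scale[OF modular_forms_subspace])
qed

lemma qm_exact_mult:
  assumes "f \<in> qm_exact k s" "g \<in> qm_exact l t"
  shows "f * g \<in> qm_exact (k + l) (s + t)"
proof -
  obtain f' g' where f': "f' \<in> modular_forms (int k - 2 * int s)" "f = f' * E2 ^ s"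
    and g': "g' \<in> modular_forms (int l - 2 * int t)" "g = g' * E2 ^ t"
    using assms by (blast elim: qm_exactE)
  have "f * g = (f' * g') * E2 ^ (s + t)"
    by (simp add: f' g' power_add mult_ac)
  moreover have "f' * g' \<in> modular_forms (int (k + l) - 2 * int (s + t))"
    using modular_forms_mult[OF f'(1) g'(1)] by (simp add: algebra_simps)
  ultimately show ?thesis
    by (simp add: qm_exactI)
qed

lemma qm_exact_eisenstein:
  "E2 \<in> qm_exact 2 1" "E4 \<in> qm_exact 4 0" "E6 \<in> qm_exact 6 0" "1 \<in> qm_exact 0 0"
proof -
  show "E2 \<in> qm_exact 2 1"
    using qm_exactI[of 1 2 1] modular_forms_monomial[of 0 0 0] by simp
  show "E4 \<in> qm_exact 4 0"
    using qm_exactI[of E4 4 0] modular_forms_monomial[of 1 0 4] by simp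
  show "E6 \<in> qm_exact 6 0"
    using qm_exactI[of E6 6 0] modular_forms_monomial[of 0 1 6] by simp
  show "1 \<in> qm_exact 0 0"
    using qm_exactI[of 1 0 0] modular_forms_monomial[of 0 0 0] by simp
qed

lemma qm_exact_power: "f \<in> qm_exact k s \<Longrightarrow> f ^ n \<in> qm_exact (n * k) (n * s)"
  by (induction n) (auto simp: qm_exact_eisenstein dest: qm_exact_mult)

text \<open>Extends multiadditive identities from forms of exact depth to the whole algebra. Scalars
  need no case, being absorbed in the exact summands.\<close>

lemma quasimodular_induct [case_names add exact]:
  assumes "\<And>f g. Q f \<Longrightarrow> Q g \<Longrightarrow> Q (f + g)"
    and "\<And>k s f. even k \<Longrightarrow> f \<in> qm_exact k s \<Longrightarrow> Q f"
  shows "Q f"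
proof -
  have "f \<in> quasimodular.span {E2 ^ i * E4 ^ j * E6 ^ l | i j l. True}"
    unfolding quasimodular_span_monomials by simp
  then show ?thesis
  proof (induction rule: quasimodular.span_induct_alt)
    case base
    show ?case
      using assms(2)[of 0 0] by (simp add: quasimodular.subspace_0 qm_exact_subspace)
  next
    case (step c x y)
    then obtain i j l where x: "x = E2 ^ i * E4 ^ j * E6 ^ l" by blast
    \<comment> \<open>Weight and depth keep the unsimplified shape in which
      \<open>qm_exact_mult\<close> and \<open>qm_exact_power\<close> produce them.\<close>
    have "x \<in> qm_exact (i * 2 + j * 4 + l * 6) (i * 1 + j * 0 + l * 0)"
      unfolding x by (intro qm_exact_mult qm_exact_power qm_exact_eisenstein)
    then have "c *\<^sub>Q x \<in> qm_exact (i * 2 + j * 4 + l * 6) (i * 1 + j * 0 + l * 0)"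
      by (rule quasimodular.subspace_scale[OF qm_exact_subspace])
    then have "Q (c *\<^sub>Q x)"
      by (rule assms(2)[rotated]) simp
    then show ?case
      using step assms(1) by blast
  qed
qed

lemma qm_exact_imp_qm_le:
  assumes "f \<in> qm_exact k s" "s \<le> t"
  shows "f \<in> qm_le k t"
proof -
  have "f = (\<Sum>j\<le>t. if j = s then f else 0)"
    using assms by simp
  moreover have "\<forall>j\<le>t. (if j = s then f else 0) \<in> qm_exact k j"
    using assms by (auto simp: quasimodular.subspace_0 qm_exact_subspace)
  ultimately show ?thesis
    unfolding qm_le_def by (intro CollectI exI[of _ "\<lambda>j. if j = s then f else 0"] conjI)
qed

lemma qm_le_subspace: "quasimodular.subspace (qm_le k s)"
proof (rule quasimodular.subspaceI)
  show "0 \<in> qm_le k s"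
    using qm_exact_imp_qm_le[OF quasimodular.subspace_0[OF qm_exact_subspace]] by blast
next
  fix f g assume "f \<in> qm_le k s" "g \<in> qm_le k s"
  then obtain h h' where "f = (\<Sum>j\<le>s. h j)" "\<forall>j\<le>s. h j \<in> qm_exact k j"
    "g = (\<Sum>j\<le>s. h' j)" "\<forall>j\<le>s. h' j \<in> qm_exact k j"
    unfolding qm_le_def by blast
  then have "f + g = (\<Sum>j\<le>s. h j + h' j)" "\<forall>j\<le>s. h j + h' j \<in> qm_exact k j"
    by (auto simp: sum.distrib quasimodular.subspace_add qm_exact_subspace)
  then show "f + g \<in> qm_le k s"
    unfolding qm_le_def by (intro CollectI exI[of _ "\<lambda>j. h j + h' j"] conjI)
next
  fix c f assume "f \<in> qm_le k s"
  then obtain h where "f = (\<Sum>j\<le>s. h j)" "\<forall>j\<le>s. h j \<in> qm_exact k j"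
    unfolding qm_le_def by blast
  then have "c *\<^sub>Q f = (\<Sum>j\<le>s. c *\<^sub>Q h j)" "\<forall>j\<le>s. c *\<^sub>Q h j \<in> qm_exact k j"
    by (auto simp: quasimodular.scale_sum_right quasimodular.subspace_scale qm_exact_subspace)
  then show "c *\<^sub>Q f \<in> qm_le k s"
    unfolding qm_le_def by (intro CollectI exI[of _ "\<lambda>j. c *\<^sub>Q h j"] conjI)
qed

text \<open>Weights 4, 6 and 8 confine \<pi> E4 and \<pi> E6; weight 12 is that of the second
  bracket of E4 with itself.\<close>

lemma modular_forms_eq_span:
  "modular_forms 4 = quasimodular.span {E4}" "modular_forms 6 = quasimodular.span {E6}"
  "modular_forms 8 = quasimodular.span {E4 ^ 2}" "modular_forms 12 = quasimodular.span {E4 ^ 3, E6 ^ 2}"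
proof -
  have "4 * int i + 6 * int j = 4 \<longleftrightarrow> i = 1 \<and> j = 0" for i j by presburger
  then have "{E4 ^ i * E6 ^ j | i j. 4 * int i + 6 * int j = 4} = {E4}" by auto
  then show "modular_forms 4 = quasimodular.span {E4}" by (simp add: modular_forms_def)
  have "4 * int i + 6 * int j = 6 \<longleftrightarrow> i = 0 \<and> j = 1" for i j by presburger
  then have "{E4 ^ i * E6 ^ j | i j. 4 * int i + 6 * int j = 6} = {E6}" by auto
  then show "modular_forms 6 = quasimodular.span {E6}" by (simp add: modular_forms_def)
  have "4 * int i + 6 * int j = 8 \<longleftrightarrow> i = 2 \<and> j = 0" for i j by presburger
  then have "{E4 ^ i * E6 ^ j | i j. 4 * int i + 6 * int j = 8} = {E4 ^ 2}" by auto
  then show "modular_forms 8 = quasimodular.span {E4 ^ 2}" by (simp add: modular_forms_def)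
  have "4 * int i + 6 * int j = 12 \<longleftrightarrow> i = 3 \<and> j = 0 \<or> i = 0 \<and> j = 2" for i j by presburger
  then have "{E4 ^ i * E6 ^ j | i j. 4 * int i + 6 * int j = 12} = {E4 ^ 3, E6 ^ 2}"
    by auto (metis mult.right_neutral power_0, metis mult.left_neutral power_0)
  then show "modular_forms 12 = quasimodular.span {E4 ^ 3, E6 ^ 2}" by (simp add: modular_forms_def)
qed

section \<open>Linear maps and derivations of the algebra\<close>

lemma qm_linearD:
  assumes "qm_linear D"
  shows "D (f + g) = D f + D g" "D (c *\<^sub>Q f) = c *\<^sub>Q D f" "D 0 = 0" "D (- f) = - D f" "D (f - g) = D f - D g"
proof -
  interpret Vector_Spaces.linear scaleQ scaleQ D
    using assms by (simp add: qm_linear_def)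
  show "D (f + g) = D f + D g" "D (c *\<^sub>Q f) = c *\<^sub>Q D f" "D 0 = 0" "D (- f) = - D f" "D (f - g) = D f - D g"
    by (rule add scale zero neg diff)+
qed

lemma qm_linear_sum: "qm_linear D \<Longrightarrow> D (sum h I) = (\<Sum>i\<in>I. D (h i))"
  by (induction I rule: infinite_finite_induct) (simp_all add: qm_linearD)

lemma qm_linearI:
  assumes "\<And>f g. D (f + g) = D f + D g" "\<And>c f. D (c *\<^sub>Q f) = c *\<^sub>Q D f"
  shows "qm_linear D"
  unfolding qm_linear_def by unfold_locales (use assms in auto)

lemma derivation_imp_ring_derivation: "derivation D \<Longrightarrow> ring_derivation D"
  by (auto simp: derivation_def ring_derivation_def qm_linearD)

lemma derivation_scale: "derivation D \<Longrightarrow> D (c *\<^sub>Q f) = c *\<^sub>Q D f"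
  by (auto simp: derivation_def qm_linearD)

lemma derivation_power:
  assumes "derivation D"
  shows "D (f ^ n) = of_nat n * f ^ (n - 1) * D f"
proof (induction n)
  case 0
  show ?case using assms by (simp add: ring_derivation_1 derivation_imp_ring_derivation)
next
  case (Suc n)
  then show ?case
    using assms by (cases n) (simp_all add: ring_derivation_mult derivation_imp_ring_derivation algebra_simps)
qed

lemma rankin_cohen_familyD:
  assumes "rankin_cohen_family \<alpha> D \<mu>" "even k" "even l" "f \<in> qm_exact k s" "g \<in> qm_exact l t"
  shows "\<mu> n f g = (\<Sum>r\<le>n. ((- 1) ^ r * ((kappa \<alpha> k s + of_nat n - 1) gchoose (n - r)) *
    ((kappa \<alpha> l t + of_nat n - 1) gchoose r)) *\<^sub>Q ((D ^^ r) f * (D ^^ (n - r)) g))"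
  using assms unfolding rankin_cohen_family_def by blast

section \<open>The derivation v and the bracket expressed by it\<close>

locale alpha_poisson =
  fixes \<alpha> :: complex and P
  assumes P: "alpha_bracket \<alpha> P"
begin

abbreviation v :: "quasimodular \<Rightarrow> quasimodular" where
  "v \<equiv> v_derivation P"

lemma P_derivation: "derivation (P f)"
  using P by (simp add: alpha_bracket_def poisson_bracket_def)

lemma P_simps:
  "P f (g + h) = P f g + P f h" "P (f + g) h = P f h + P g h"
  "P f (c *\<^sub>Q g) = c *\<^sub>Q P f g" "P (c *\<^sub>Q f) g = c *\<^sub>Q P f g"
  "P f (g - h) = P f g - P f h" "P (f - g) h = P f h - P g h"
  "P f 0 = 0" "P 0 f = 0"
proof -
  have lin: "qm_linear (P f)" "qm_linear (\<lambda>f. P f g)" for f g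
    using P by (simp_all add: alpha_bracket_def poisson_bracket_def qm_bilinear_def)
  show "P f (g + h) = P f g + P f h" "P f (c *\<^sub>Q g) = c *\<^sub>Q P f g"
    "P f (g - h) = P f g - P f h" "P f 0 = 0"
    by (rule qm_linearD[OF lin(1)])+
  show "P (f + g) h = P f h + P g h" "P (c *\<^sub>Q f) g = c *\<^sub>Q P f g"
    "P (f - g) h = P f h - P g h" "P 0 f = 0"
    by (rule qm_linearD[OF lin(2)])+
qed

lemma P_self: "P f f = 0"
  using P by (simp add: alpha_bracket_def poisson_bracket_def)

lemma P_commute: "P f g = - P g f"
proof -
  have "P (f + g) (f + g) = P f g + P g f"
    unfolding P_simps(1,2) by (simp add: P_self)
  then show ?thesis
    unfolding P_self by (metis eq_neg_iff_add_eq_0)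
qed

lemma P_eisenstein:
  "P E4 E6 = (-2) *\<^sub>Q Delta" "P E2 E4 = \<alpha> *\<^sub>Q (E6 * E2)" "P E2 E6 = (3 / 2 * \<alpha>) *\<^sub>Q (E4 ^ 2 * E2)"
  using P by (simp_all add: alpha_bracket_def)

lemma P_mult_right: "P f (g * h) = P f g * h + g * P f h"
  using ring_derivation_mult[OF derivation_imp_ring_derivation[OF P_derivation]] .

lemma P_mult_left: "P (g * h) f = P g f * h + g * P h f"
  using P_mult_right[of f g h] P_commute[of "g * h" f] P_commute[of g f] P_commute[of h f] by simp

lemma Delta_nonzero: "Delta \<noteq> 0"
  using coeffs012_weight12(1,2) unfolding Delta_def by auto

lemma v_eqI:
  assumes "12 *\<^sub>Q (Delta * g) = P Delta f"
  shows "v f = g"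
  unfolding v_derivation_def
proof (rule the_equality[of "\<lambda>g. 12 *\<^sub>Q (Delta * g) = P Delta f", OF assms])
  fix h assume "12 *\<^sub>Q (Delta * h) = P Delta f"
  then have "12 *\<^sub>Q (Delta * (h - g)) = 0"
    using assms by (simp add: right_diff_distrib scaleQ_simps)
  then show "h = g"
    using Delta_nonzero by (simp add: quasimodular.scale_eq_0_iff)
qed

lemma P_Delta_left: "P Delta f = 3 *\<^sub>Q (E4 ^ 2 * P E4 f) - 2 *\<^sub>Q (E6 * P E6 f)"
proof -
  have "P Delta f = P (E4 * E4 * E4) f - P (E6 * E6) f"
    by (simp only: Delta_def power3_eq_cube power2_eq_square P_simps)
  then show ?thesis
    unfolding P_mult_left by (simp add: quasimodular_pointwise power2_eq_square algebra_simps)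
qed

text \<open>For E2 the two terms of \<open>P_Delta_left\<close> cancel, thanks to the factor 3 / 2
  in the bracket of E2 and E6. For E4 and E6 one term survives, and it contains
  \<open>Delta\<close>.\<close>

lemma v_eisenstein_aux:
  "12 *\<^sub>Q (Delta * 0) = P Delta E2" "12 *\<^sub>Q (Delta * ((- 1 / 3) *\<^sub>Q E6)) = P Delta E4"
  "12 *\<^sub>Q (Delta * ((- 1 / 2) *\<^sub>Q E4 ^ 2)) = P Delta E6"
  unfolding P_Delta_left P_commute[of E4 E2] P_commute[of E6 E2] P_commute[of E6 E4] P_self P_eisenstein
  by (simp_all add: quasimodular_pointwise)

lemma v_eisenstein: "v E2 = 0" "v E4 = (- 1 / 3) *\<^sub>Q E6" "v E6 = (- 1 / 2) *\<^sub>Q E4 ^ 2"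
  using v_eisenstein_aux by (auto intro!: v_eqI)

text \<open>By the Leibniz rule, the f whose bracket with \<open>Delta\<close> is divisible by
  \<open>Delta\<close> form a subalgebra; it contains the generators.\<close>

lemma P_Delta_divisible: "\<exists>g. 12 *\<^sub>Q (Delta * g) = P Delta f"
proof -
  let ?Q = "\<lambda>f. \<exists>g. 12 *\<^sub>Q (Delta * g) = P Delta f"
  have mult: "?Q (f * f')" if "?Q f" "?Q f'" for f f'
  proof -
    obtain g g' where "12 *\<^sub>Q (Delta * g) = P Delta f" "12 *\<^sub>Q (Delta * g') = P Delta f'"
      using \<open>?Q f\<close> \<open>?Q f'\<close> by blast
    moreover have "12 *\<^sub>Q (Delta * (g * f' + f * g')) = 12 *\<^sub>Q (Delta * g) * f' + f * (12 *\<^sub>Q (Delta * g'))"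
      by (simp add: distrib_left scaleQ_simps mult_ac)
    ultimately have "12 *\<^sub>Q (Delta * (g * f' + f * g')) = P Delta (f * f')"
      by (simp add: P_mult_right)
    then show ?thesis by blast
  qed
  have one: "?Q 1"
    using ring_derivation_1[OF derivation_imp_ring_derivation[OF P_derivation]] by (intro exI[of _ 0]) simp
  have power: "?Q (f ^ n)" if "?Q f" for f n
    by (induction n) (use one mult that in auto)
  have eisenstein: "?Q E2" "?Q E4" "?Q E6"
    using v_eisenstein_aux by blast+
  have "f \<in> quasimodular.span {E2 ^ i * E4 ^ j * E6 ^ l | i j l. True}"
    unfolding quasimodular_span_monomials by simp
  then show ?thesis
  proof (induction rule: quasimodular.span_induct_alt)
    case base
    show ?case by (intro exI[of _ 0]) (simp add: P_simps)
  next
    case (step c x y)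
    then obtain i j l where x: "x = E2 ^ i * E4 ^ j * E6 ^ l" by blast
    have "?Q x"
      unfolding x by (intro mult power eisenstein)
    then obtain g h where "12 *\<^sub>Q (Delta * g) = P Delta x" "12 *\<^sub>Q (Delta * h) = P Delta y"
      using step by blast
    moreover have "12 *\<^sub>Q (Delta * (c *\<^sub>Q g + h)) = c *\<^sub>Q (12 *\<^sub>Q (Delta * g)) + 12 *\<^sub>Q (Delta * h)"
      by (simp add: distrib_left scaleQ_simps mult.commute)
    ultimately have "12 *\<^sub>Q (Delta * (c *\<^sub>Q g + h)) = P Delta (c *\<^sub>Q x + y)"
      by (simp add: P_simps)
    then show ?case by blast
  qed
qed

lemma v_eq: "12 *\<^sub>Q (Delta * v f) = P Delta f"
proof -
  obtain g where g: "12 *\<^sub>Q (Delta * g) = P Delta f"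
    using P_Delta_divisible by blast
  then show ?thesis
    by (simp only: v_eqI[OF g])
qed

lemma v_derivation: "derivation v"
  unfolding derivation_def
proof (intro conjI allI qm_linearI)
  show "v (f + g) = v f + v g" for f g
    by (rule v_eqI) (simp add: P_simps distrib_left scaleQ_simps v_eq)
  show "v (c *\<^sub>Q f) = c *\<^sub>Q v f" for c f
    by (rule v_eqI) (simp add: P_simps scaleQ_simps mult.commute flip: v_eq)
  show "v (f * g) = v f * g + f * v g" for f g
  proof (rule v_eqI)
    have "12 *\<^sub>Q (Delta * (v f * g + f * v g)) = 12 *\<^sub>Q (Delta * v f) * g + f * (12 *\<^sub>Q (Delta * v g))"
      by (simp add: distrib_left scaleQ_simps mult_ac)
    then show "12 *\<^sub>Q (Delta * (v f * g + f * v g)) = P Delta (f * g)"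
      by (simp add: v_eq P_mult_right)
  qed
qed

lemmas P_one = ring_derivation_1[OF derivation_imp_ring_derivation[OF P_derivation]]
lemmas v_one = ring_derivation_1[OF derivation_imp_ring_derivation[OF v_derivation]]
lemmas v_mult = ring_derivation_mult[OF derivation_imp_ring_derivation[OF v_derivation]]
lemmas v_add = ring_derivation_add[OF derivation_imp_ring_derivation[OF v_derivation]]
lemmas v_zero = ring_derivation_0[OF derivation_imp_ring_derivation[OF v_derivation]]
lemmas v_scale = derivation_scale[OF v_derivation]

text \<open>By its values on E4 and E6, v is the Serre derivative on modular forms, and it raises
  the weight by 2 on each monomial.\<close>

lemma v_modular:
  assumes "f \<in> modular_forms k"
  shows "v f \<in> modular_forms (k + 2)"
  using assms
proof (induction rule: modular_forms_induct)
  case zero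
  show ?case by (simp add: v_zero quasimodular.subspace_0 modular_forms_subspace)
next
  case (step c i j g)
  \<comment> \<open>The factor \<open>of_nat i\<close> stays inside because the exponent i - 1 is
    truncated at i = 0, where the term vanishes.\<close>
  have 1: "of_nat i * E4 ^ (i - 1) * E6 ^ Suc j \<in> modular_forms (k + 2)"
  proof (cases i)
    case 0
    then show ?thesis by (simp add: quasimodular.subspace_0 modular_forms_subspace)
  next
    case (Suc i')
    have "of_nat i * E4 ^ (i - 1) * E6 ^ Suc j = of_nat i *\<^sub>Q (E4 ^ i' * E6 ^ Suc j)"
      by (simp add: quasimodular_pointwise Suc)
    moreover have "E4 ^ i' * E6 ^ Suc j \<in> modular_forms (k + 2)"
      using step Suc by (intro modular_forms_monomial) simp
    ultimately show ?thesis by (simp add: quasimodular.subspace_scale modular_forms_subspace)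
  qed
  have 2: "of_nat j * E4 ^ (i + 2) * E6 ^ (j - 1) \<in> modular_forms (k + 2)"
  proof (cases j)
    case 0
    then show ?thesis by (simp add: quasimodular.subspace_0 modular_forms_subspace)
  next
    case (Suc j')
    have "of_nat j * E4 ^ (i + 2) * E6 ^ (j - 1) = of_nat j *\<^sub>Q (E4 ^ (i + 2) * E6 ^ j')"
      by (simp add: quasimodular_pointwise Suc)
    moreover have "E4 ^ (i + 2) * E6 ^ j' \<in> modular_forms (k + 2)"
      using step Suc by (intro modular_forms_monomial) simp
    ultimately show ?thesis by (simp add: quasimodular.subspace_scale modular_forms_subspace)
  qed
  have "v (c *\<^sub>Q (E4 ^ i * E6 ^ j) + g) = c *\<^sub>Q ((- 1 / 3) *\<^sub>Q (of_nat i * E4 ^ (i - 1) * E6 ^ Suc j) +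
      (- 1 / 2) *\<^sub>Q (of_nat j * E4 ^ (i + 2) * E6 ^ (j - 1))) + v g"
    by (simp add: v_add v_scale v_mult derivation_power[OF v_derivation] v_eisenstein
        quasimodular_pointwise power_add) (simp add: algebra_simps power2_eq_square)
  also have "\<dots> \<in> modular_forms (k + 2)"
    by (intro quasimodular.subspace_add[OF modular_forms_subspace]
        quasimodular.subspace_scale[OF modular_forms_subspace] 1 2 step)
  finally show ?case .
qed

lemma v_E2_power: "v (E2 ^ n) = 0"
  by (simp add: derivation_power[OF v_derivation] v_eisenstein)

text \<open>As v annihilates E2, it acts on the modular factor only.\<close>

lemma v_exact:
  assumes "f \<in> qm_exact k s"
  shows "v f \<in> qm_exact (k + 2) s"
proof -
  obtain g where g: "g \<in> modular_forms (int k - 2 * int s)" "f = g * E2 ^ s"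
    using assms by (rule qm_exactE)
  have "v f = v g * E2 ^ s"
    by (simp add: g v_mult v_E2_power)
  moreover have "v g \<in> modular_forms (int (k + 2) - 2 * int s)"
    using v_modular[OF g(1)] by (simp add: algebra_simps)
  ultimately show ?thesis by (simp add: qm_exactI)
qed

lemma v_funpow_exact: "f \<in> qm_exact k s \<Longrightarrow> (v ^^ r) f \<in> qm_exact (k + 2 * r) s"
  by (induction r) (auto dest: v_exact simp: add_ac)

text \<open>The formula of part (i) for b = 0, with free scalars as weights. For fixed g it passes
  to products in f, the weights adding up, and to combinations of equal weight, so it spreads from
  the generators.\<close>

definition weighted :: "complex \<Rightarrow> quasimodular \<Rightarrow> complex \<Rightarrow> quasimodular \<Rightarrow> bool" where
  "weighted w f w' g \<longleftrightarrow> P f g = w *\<^sub>Q (f * v g) - w' *\<^sub>Q (g * v f)"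

lemma weighted_swap: "weighted w f w' g \<Longrightarrow> weighted w' g w f"
  unfolding weighted_def by (subst P_commute) simp

lemma weighted_one: "weighted 0 1 w g"
proof -
  have "P 1 g = 0" "v 1 = 0"
    using P_commute[of 1 g] by (simp_all add: P_one v_one)
  then show ?thesis by (simp add: weighted_def)
qed

lemma weighted_mult:
  assumes "weighted w f w' g" "weighted u h w' g"
  shows "weighted (w + u) (f * h) w' g"
  using assms unfolding weighted_def
  by (simp add: P_mult_left v_mult quasimodular_pointwise) (simp add: algebra_simps)

lemma weighted_power:
  assumes "weighted w f w' g"
  shows "weighted (of_nat n * w) (f ^ n) w' g"
  by (induction n) (use assms weighted_one weighted_mult in \<open>simp_all add: distrib_right\<close>)

lemma weighted_lincomb:
  assumes "weighted w f w' g" "weighted w h w' g"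
  shows "weighted w (c *\<^sub>Q f + h) w' g"
  using assms unfolding weighted_def
  by (simp add: P_simps v_add v_scale quasimodular_pointwise) (simp add: algebra_simps)

text \<open>The weights - 3 \<alpha>, 4 and 6 are the values of \<open>kappa\<close> on E2, E4 and
  E6.\<close>

lemma weighted_exact:
  assumes "weighted (- 3 * \<alpha>) E2 w' g" "weighted 4 E4 w' g" "weighted 6 E6 w' g" "f \<in> qm_exact k s"
  shows "weighted (kappa \<alpha> k s) f w' g"
proof -
  obtain h where h: "h \<in> modular_forms (int k - 2 * int s)" "f = h * E2 ^ s"
    using assms(4) by (rule qm_exactE)
  have "weighted (of_int (int k - 2 * int s)) h w' g"
    using h(1)
  proof (induction rule: modular_forms_induct)
    case zero
    show ?case by (simp add: weighted_def P_simps v_zero)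
  next
    case (step c i j h)
    have "weighted (of_nat i * 4 + of_nat j * 6) (E4 ^ i * E6 ^ j) w' g"
      by (intro weighted_mult weighted_power assms)
    also have "of_nat i * 4 + of_nat j * 6 = (of_int (int k - 2 * int s) :: complex)"
      unfolding step(1)[symmetric] by simp
    finally show ?case
      using step(2) by (rule weighted_lincomb)
  qed
  from weighted_mult[OF this weighted_power[OF assms(1), of s]] show ?thesis
    by (simp add: h kappa_def algebra_simps)
qed

text \<open>Together with \<open>weighted_swap\<close> this covers all nine pairs of generators. The
  diagonal pairs hold for every weight by antisymmetry; the other three encode the defining values
  of the bracket.\<close>

lemma weighted_eisenstein:
  "weighted w E2 w E2" "weighted w E4 w E4" "weighted w E6 w E6"
  "weighted 4 E4 6 E6" "weighted (- 3 * \<alpha>) E2 4 E4" "weighted (- 3 * \<alpha>) E2 6 E6"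
  unfolding weighted_def P_self P_eisenstein v_eisenstein Delta_def
  by (simp_all add: quasimodular_pointwise) (simp_all add: field_simps power2_eq_square power3_eq_cube)

text \<open>\<open>weighted_exact\<close> is applied to f against each generator and then, after a
  swap, to g.\<close>

lemma P_eq_v:
  assumes f: "f \<in> qm_exact k s" and g: "g \<in> qm_exact l t"
  shows "P f g = kappa \<alpha> k s *\<^sub>Q (f * v g) - kappa \<alpha> l t *\<^sub>Q (g * v f)"
proof -
  note e = weighted_eisenstein and s = weighted_eisenstein[THEN weighted_swap]
  have "weighted (kappa \<alpha> k s) f (- 3 * \<alpha>) E2" "weighted (kappa \<alpha> k s) f 4 E4" "weighted (kappa \<alpha> k s) f 6 E6"
    by (rule weighted_exact[OF _ _ _ f]; rule e s)+
  then have "weighted (kappa \<alpha> k s) f (kappa \<alpha> l t) g"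
    by (intro weighted_swap[OF weighted_exact[OF _ _ _ g]]) (rule weighted_swap, assumption)+
  then show ?thesis
    by (simp add: weighted_def)
qed

section \<open>The formal deformation given by v\<close>

sublocale RC: scalar_derivation "\<lambda>c. c *\<^sub>Q 1" v
  by unfold_locales
    (simp_all add: quasimodular.scale_left_distrib scaleQ_simps v_scale v_one
      derivation_imp_ring_derivation v_derivation)

lemma rankin_cohen_eq:
  "RC.rankin_cohen k l n f g =
     (\<Sum>r\<le>n. ((- 1) ^ r * ((k + of_nat n - 1) gchoose (n - r)) * ((l + of_nat n - 1) gchoose r))
        *\<^sub>Q ((v ^^ r) f * (v ^^ (n - r)) g))"
  by (simp add: RC.rankin_cohen_def scaleQ_mult_left)

lemma rankin_cohen_exact:
  assumes "f \<in> qm_exact k s" "g \<in> qm_exact l t"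
  shows "RC.rankin_cohen w w' n f g \<in> qm_exact (k + l + 2 * n) (s + t)"
  unfolding rankin_cohen_eq
proof (intro quasimodular.subspace_sum[OF qm_exact_subspace] quasimodular.subspace_scale[OF qm_exact_subspace])
  fix r assume "r \<in> {..n}"
  then have "k + 2 * r + (l + 2 * (n - r)) = k + l + 2 * n" by simp
  then show "(v ^^ r) f * (v ^^ (n - r)) g \<in> qm_exact (k + l + 2 * n) (s + t)"
    using qm_exact_mult[OF v_funpow_exact[OF assms(1), of r] v_funpow_exact[OF assms(2), of "n - r"]]
    by (simp only:)
qed

text \<open>Matches the growth of \<open>kappa\<close> under the bracket with the inner weights in
  \<open>rankin_cohen_assoc\<close>.\<close>

lemma kappa_rankin_cohen:
  "kappa \<alpha> (k + l + 2 * r) (s + t) = kappa \<alpha> k s + kappa \<alpha> l t + 2 * of_nat r"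
  by (simp add: kappa_def algebra_simps)

text \<open>On exact forms \<mu> is the Rankin-Cohen bracket for v. Since v preserves depth, its
  values are again exact, so the formula also governs the outer bracket and
  \<open>rankin_cohen_assoc\<close> applies. Trilinearity does the rest.\<close>

lemma
  assumes "rankin_cohen_family \<alpha> v \<mu>"
  shows formal_deformation_v: "formal_deformation \<mu>"
    and weight_depth_compatible_v: "weight_depth_compatible \<mu>"
proof -
  have lin: "qm_linear (\<mu> n f)" "qm_linear (\<lambda>f. \<mu> n f g)" for n f g
    using assms by (simp_all add: rankin_cohen_family_def qm_bilinear_def)
  have exact: "\<mu> n f g = RC.rankin_cohen (kappa \<alpha> k s) (kappa \<alpha> l t) n f g"
    if "even k" "even l" "f \<in> qm_exact k s" "g \<in> qm_exact l t" for n k l s t f g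
    unfolding rankin_cohen_eq by (rule rankin_cohen_familyD[OF assms that])
  have mem: "\<mu> n f g \<in> qm_exact (k + l + 2 * n) (s + t)"
    if "even k" "even l" "f \<in> qm_exact k s" "g \<in> qm_exact l t" for n k l s t f g
    using exact[OF that] rankin_cohen_exact[OF that(3,4)] by simp
  have zero: "\<mu> 0 f g = f * g" for f g
  proof (induction f rule: quasimodular_induct)
    case (add f f')
    then show ?case by (simp add: qm_linearD(1)[OF lin(2)] distrib_right)
  next
    case f: (exact k s f)
    show ?case
    proof (induction g rule: quasimodular_induct)
      case (add g g')
      then show ?case by (simp add: qm_linearD(1)[OF lin(1)] distrib_left)
    next
      case g: (exact l t g)
      show ?case
        unfolding exact[OF f(1) g(1) f(2) g(2)] by (simp add: rankin_cohen_eq)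
    qed
  qed
  have assoc: "(\<Sum>r\<le>n. \<mu> (n - r) (\<mu> r f g) h) = (\<Sum>r\<le>n. \<mu> (n - r) f (\<mu> r g h))" for n f g h
  proof (induction f rule: quasimodular_induct)
    case (add f f')
    then show ?case by (simp add: qm_linearD(1)[OF lin(1)] qm_linearD(1)[OF lin(2)] sum.distrib)
  next
    case f: (exact k s f)
    show ?case
    proof (induction g rule: quasimodular_induct)
      case (add g g')
      then show ?case by (simp add: qm_linearD(1)[OF lin(1)] qm_linearD(1)[OF lin(2)] sum.distrib)
    next
      case g: (exact l t g)
      show ?case
      proof (induction h rule: quasimodular_induct)
        case (add h h')
        then show ?case by (simp add: qm_linearD(1)[OF lin(1)] qm_linearD(1)[OF lin(2)] sum.distrib)
      next
        case h: (exact m u h)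
        have "\<mu> (n - r) (\<mu> r f g) h =
            RC.rankin_cohen (kappa \<alpha> k s + kappa \<alpha> l t + 2 * of_nat r) (kappa \<alpha> m u) (n - r)
              (RC.rankin_cohen (kappa \<alpha> k s) (kappa \<alpha> l t) r f g) h" for r
          using exact[OF _ h(1) mem[OF f(1) g(1) f(2) g(2), of r] h(2), of "n - r"] f g
          by (simp add: exact[OF f(1) g(1) f(2) g(2)] kappa_rankin_cohen)
        moreover have "\<mu> (n - r) f (\<mu> r g h) =
            RC.rankin_cohen (kappa \<alpha> k s) (kappa \<alpha> l t + kappa \<alpha> m u + 2 * of_nat r) (n - r)
              f (RC.rankin_cohen (kappa \<alpha> l t) (kappa \<alpha> m u) r g h)" for r
          using exact[OF f(1) _ f(2) mem[OF g(1) h(1) g(2) h(2), of r], of "n - r"] g h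
          by (simp add: exact[OF g(1) h(1) g(2) h(2)] kappa_rankin_cohen)
        ultimately show ?case
          by (simp add: RC.rankin_cohen_assoc)
      qed
    qed
  qed
  show "formal_deformation \<mu>"
    unfolding formal_deformation_def qm_bilinear_def using lin zero assoc by (auto simp: fun_eq_iff)
  show "weight_depth_compatible \<mu>"
    unfolding weight_depth_compatible_def
  proof (intro allI impI ballI)
    fix n k l s t f g
    assume even: "even k" "even l" and "f \<in> qm_le k s" "g \<in> qm_le l t"
    then obtain h h' where h: "f = (\<Sum>i\<le>s. h i)" "\<forall>i\<le>s. h i \<in> qm_exact k i"
      and h': "g = (\<Sum>j\<le>t. h' j)" "\<forall>j\<le>t. h' j \<in> qm_exact l j"
      unfolding qm_le_def by blast
    have "\<mu> n f g = (\<Sum>i\<le>s. \<Sum>j\<le>t. \<mu> n (h i) (h' j))"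
      unfolding h(1) h'(1) qm_linear_sum[OF lin(1)] qm_linear_sum[OF lin(2)] by (rule sum.swap)
    also have "\<dots> \<in> qm_le (k + l + 2 * n) (s + t)"
      using h(2) h'(2)
      by (intro quasimodular.subspace_sum[OF qm_le_subspace] qm_exact_imp_qm_le[OF mem[OF even]]) auto
    finally show "\<mu> n f g \<in> qm_le (k + l + 2 * n) (s + t)" .
  qed
qed

end

section \<open>The line of admissible derivations\<close>

lemma qm_le_1E:
  assumes "f \<in> qm_le k 1"
  obtains g h where "g \<in> modular_forms (int k)" "h \<in> modular_forms (int k - 2)" "f = g + h * E2"
proof -
  obtain h where h: "f = (\<Sum>j\<le>1. h j)" "\<forall>j\<le>1. h j \<in> qm_exact k j"
    using assms unfolding qm_le_def by blast
  then have "h 0 \<in> qm_exact k 0" "h 1 \<in> qm_exact k 1" "f = h 0 + h 1"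
    by auto
  then show ?thesis
    by (auto elim!: qm_exactE intro: that)
qed

lemma qm_le_0: "qm_le k 0 = modular_forms (int k)"
  unfolding qm_le_def qm_exact_def by auto

text \<open>The defining relation against E4 determines \<pi> from \<pi> E4. Being complex-like
  confines \<pi> E4 to the span of E6 and E4 E2, and the relation between E4 and E6 removes the E6
  component.\<close>

lemma pi_space_generator:
  assumes "generator_of_line \<pi> (pi_space \<alpha>)"
  obtains c where "c \<noteq> 0"
    and "\<And>k s f. even k \<Longrightarrow> f \<in> qm_exact k s \<Longrightarrow> \<pi> f = (c * kappa \<alpha> k s) *\<^sub>Q (f * E2)"
    and "derivation \<pi>"
proof -
  have "(\<lambda>f. 1 *\<^sub>Q \<pi> f) \<in> pi_space \<alpha>"
    using assms unfolding generator_of_line_def by blast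
  then have "\<pi> \<in> pi_space \<alpha>"
    by simp
  then have comm: "kappa \<alpha> k s *\<^sub>Q (f * \<pi> g) = kappa \<alpha> l t *\<^sub>Q (g * \<pi> f)"
    if "even k" "even l" "f \<in> qm_exact k s" "g \<in> qm_exact l t" for k l s t f g
  proof -
    have "kappa \<alpha> k s *\<^sub>Q (f * \<pi> g) - kappa \<alpha> l t *\<^sub>Q (g * \<pi> f) = 0"
      using \<open>\<pi> \<in> pi_space \<alpha>\<close> that unfolding pi_space_def by blast
    then show ?thesis by simp
  qed
  have like: "complex_like \<pi>"
    using \<open>\<pi> \<in> pi_space \<alpha>\<close> by (simp add: pi_space_def)
  then have deriv: "derivation \<pi>"
    by (simp add: complex_like_def)
  have depth_1: "\<pi> f \<in> qm_le (k + 2) 1" if "even k" "f \<in> qm_exact k 0" for k f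
  proof -
    have "\<pi> ` qm_le k 0 \<subseteq> qm_le (k + 2) (0 + 1)"
      using like \<open>even k\<close> unfolding complex_like_def by blast
    then show ?thesis
      using qm_exact_imp_qm_le[OF that(2) order_refl] by (simp add: image_subset_iff)
  qed
  have "\<pi> E4 \<in> qm_le 6 1" "\<pi> E6 \<in> qm_le 8 1"
    using depth_1[OF _ qm_exact_eisenstein(2)] depth_1[OF _ qm_exact_eisenstein(3)] by simp_all
  then obtain x y x' y' where E4: "\<pi> E4 = x *\<^sub>Q E6 + y *\<^sub>Q (E4 * E2)"
    and E6: "\<pi> E6 = x' *\<^sub>Q E4 ^ 2 + y' *\<^sub>Q (E6 * E2)"
    by (elim qm_le_1E) (auto simp: modular_forms_eq_span quasimodular.span_singleton scaleQ_mult_left)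
  have "4 *\<^sub>Q (E4 * \<pi> E6) = 6 *\<^sub>Q (E6 * \<pi> E4)"
    using comm[OF _ _ qm_exact_eisenstein(2,3)] by (simp add: kappa_def)
  \<comment> \<open>Only the side with \<pi> E4 contributes E6^2, so the coefficient of E6^2
    isolates x.\<close>
  then have "(4 * x') *\<^sub>Q E4 ^ 3 + (4 * y' - 6 * y) *\<^sub>Q (E4 * (E6 * E2)) + (- 6 * x) *\<^sub>Q E6 ^ 2 = 0"
    unfolding E4 E6 quasimodular_pointwise
    by (simp add: power2_eq_square power3_eq_cube algebra_simps)
  then have "- 6 * x = 0"
    by (rule E6_square_independent)
  then have "x = 0"
    by simp
  \<comment> \<open>The divisor 4 is the value of \<open>kappa\<close> on E4.\<close>
  define c where "c = y / 4"
  have exact: "\<pi> f = (c * kappa \<alpha> k s) *\<^sub>Q (f * E2)" if "even k" "f \<in> qm_exact k s" for k s f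
  proof -
    have "4 *\<^sub>Q (E4 * \<pi> f) = kappa \<alpha> k s *\<^sub>Q (f * \<pi> E4)"
      using comm[OF _ that(1) qm_exact_eisenstein(2) that(2)] by (simp add: kappa_def)
    then have "4 *\<^sub>Q (E4 * (\<pi> f - (c * kappa \<alpha> k s) *\<^sub>Q (f * E2))) = 0"
      unfolding E4 \<open>x = 0\<close> c_def by (simp add: quasimodular_pointwise algebra_simps)
    then show ?thesis
      using E4_nonzero by (simp add: quasimodular.scale_eq_0_iff)
  qed
  have "c \<noteq> 0"
  proof
    assume "c = 0"
    have "\<pi> f = 0" for f
      by (induction f rule: quasimodular_induct)
        (use exact \<open>c = 0\<close> ring_derivation_add[OF derivation_imp_ring_derivation[OF deriv]] in auto)
    then show False
      using assms by (auto simp: generator_of_line_def)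
  qed
  then show ?thesis
    using exact deriv by (rule that)
qed

section \<open>The effect of adding a multiple of \<pi> to v\<close>

locale alpha_poisson_generator = alpha_poisson +
  fixes \<pi> :: "quasimodular \<Rightarrow> quasimodular" and b c :: complex
  assumes pi_exact: "\<And>k s f. even k \<Longrightarrow> f \<in> qm_exact k s \<Longrightarrow> \<pi> f = (c * kappa \<alpha> k s) *\<^sub>Q (f * E2)"
    and pi_derivation: "derivation \<pi>"
begin

abbreviation \<delta> :: "quasimodular \<Rightarrow> quasimodular" where
  "\<delta> \<equiv> delta_derivation P \<pi> b"

lemma delta_exact:
  "even k \<Longrightarrow> f \<in> qm_exact k s \<Longrightarrow> \<delta> f = v f + (b * c * kappa \<alpha> k s) *\<^sub>Q (f * E2)"
  by (simp add: delta_derivation_def pi_exact add.commute mult.assoc)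

lemma delta_linear: "\<delta> (f + g) = \<delta> f + \<delta> g" "\<delta> (a *\<^sub>Q f) = a *\<^sub>Q \<delta> f"
  by (simp_all add: delta_derivation_def v_add v_scale scaleQ_simps derivation_scale[OF pi_derivation]
      ring_derivation_add[OF derivation_imp_ring_derivation[OF pi_derivation]] mult.commute)

text \<open>The two contributions of \<pi> are both b c \<open>kappa\<close>(f)
  \<open>kappa\<close>(g) f g E2 and cancel, which leaves \<open>P_eq_v\<close>.\<close>

lemma P_eq_delta:
  assumes "even k" "even l" "f \<in> qm_exact k s" "g \<in> qm_exact l t"
  shows "P f g = kappa \<alpha> k s *\<^sub>Q (f * \<delta> g) - kappa \<alpha> l t *\<^sub>Q (g * \<delta> f)"
  unfolding P_eq_v[OF assms(3,4)] delta_exact[OF assms(1,3)] delta_exact[OF assms(2,4)]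
  by (simp add: quasimodular_pointwise algebra_simps)

text \<open>For \<alpha> = - 1 / 3 the element e = b c E2 has \<open>kappa\<close> equal to 1 and v
  e = 0, which is the situation of \<open>twist\<close>.\<close>

lemma delta_funpow_exceptional:
  assumes "\<alpha> = - 1 / 3" "even k" "f \<in> qm_exact k s"
  shows "(\<delta> ^^ r) f = RC.twist ((b * c) *\<^sub>Q E2) (kappa \<alpha> k s) f r"
proof (rule RC.funpow_eq_twist)
  show "\<delta> (f + g) = \<delta> f + \<delta> g" for f g
    by (rule delta_linear)
  show "\<delta> ((a *\<^sub>Q 1) * f) = (a *\<^sub>Q 1) * \<delta> f" for a f
    by (simp add: scaleQ_mult_left delta_linear)
  fix p i
  define e where "e = (b * c) *\<^sub>Q E2"
  have "e \<in> qm_exact 2 1"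
    unfolding e_def by (intro quasimodular.subspace_scale[OF qm_exact_subspace] qm_exact_eisenstein)
  then have mem: "e ^ p * (v ^^ i) f \<in> qm_exact (p * 2 + (k + 2 * i)) (p * 1 + s)"
    by (intro qm_exact_mult qm_exact_power v_funpow_exact assms)
  have "v (e ^ p) = 0"
    by (simp add: derivation_power[OF v_derivation] e_def v_scale v_eisenstein)
  moreover have "kappa \<alpha> (p * 2 + (k + 2 * i)) (p * 1 + s) = kappa \<alpha> k s + 2 * of_nat i + of_nat p"
    by (simp add: kappa_def assms(1))
  ultimately have "\<delta> (e ^ p * (v ^^ i) f) =
      e ^ p * (v ^^ Suc i) f + (b * c * (kappa \<alpha> k s + 2 * of_nat i + of_nat p)) *\<^sub>Q (e ^ p * (v ^^ i) f * E2)"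
    using delta_exact[OF _ mem] assms(2) by (simp add: v_mult)
  also have "(b * c * (kappa \<alpha> k s + 2 * of_nat i + of_nat p)) *\<^sub>Q (e ^ p * (v ^^ i) f * E2) =
      ((kappa \<alpha> k s + 2 * of_nat i + of_nat p) *\<^sub>Q 1) * (e ^ Suc p * (v ^^ i) f)"
    by (simp add: quasimodular_pointwise e_def algebra_simps)
  finally show "\<delta> (((b * c) *\<^sub>Q E2) ^ p * (v ^^ i) f) = ((b * c) *\<^sub>Q E2) ^ p * (v ^^ Suc i) f +
      ((kappa \<alpha> k s + 2 * of_nat i + of_nat p) *\<^sub>Q 1) * (((b * c) *\<^sub>Q E2) ^ Suc p * (v ^^ i) f)"
    by (simp only: e_def)
qed

text \<open>Either \<delta> is v, or its powers are twists of those of v, which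
  \<open>rankin_cohen_twist\<close> removes from the brackets.\<close>

lemma rankin_cohen_family_delta_imp_v:
  assumes "b = 0 \<or> \<alpha> = - 1 / 3" and \<mu>: "rankin_cohen_family \<alpha> \<delta> \<mu>"
  shows "rankin_cohen_family \<alpha> v \<mu>"
proof (cases "b = 0")
  case True
  then have "\<delta> = v"
    by (simp add: fun_eq_iff delta_derivation_def)
  then show ?thesis
    using \<mu> by simp
next
  case False
  then have \<alpha>: "\<alpha> = - 1 / 3"
    using assms by blast
  have "\<mu> n f g = RC.rankin_cohen (kappa \<alpha> k s) (kappa \<alpha> l t) n f g"
    if "even k" "even l" "f \<in> qm_exact k s" "g \<in> qm_exact l t" for n k l s t f g
  proof -
    show ?thesis
      unfolding rankin_cohen_familyD[OF \<mu> that]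
        delta_funpow_exceptional[OF \<alpha> that(1,3)] delta_funpow_exceptional[OF \<alpha> that(2,4)]
        RC.rankin_cohen_twist[where e = "(b * c) *\<^sub>Q E2", symmetric] by (simp add: scaleQ_mult_left)
  qed
  moreover have "qm_bilinear (\<mu> n)" for n
    using \<mu> by (simp add: rankin_cohen_family_def)
  ultimately show ?thesis
    by (simp add: rankin_cohen_family_def rankin_cohen_eq)
qed

lemma not_weight_depth_compatible:
  assumes "b \<noteq> 0" "c \<noteq> 0" "\<alpha> \<noteq> - 1 / 3" and \<mu>: "rankin_cohen_family \<alpha> \<delta> \<mu>"
  shows "\<not> weight_depth_compatible \<mu>"
proof
  assume compatible: "weight_depth_compatible \<mu>"
  define \<beta> where "\<beta> = b * c"
  have E4: "\<delta> E4 = (- 1 / 3) *\<^sub>Q E6 + (4 * \<beta>) *\<^sub>Q (E4 * E2)"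
    using delta_exact[OF _ qm_exact_eisenstein(2)] by (simp add: v_eisenstein kappa_def \<beta>_def mult.commute)
  have E6: "\<delta> E6 = (- 1 / 2) *\<^sub>Q E4 ^ 2 + (6 * \<beta>) *\<^sub>Q (E6 * E2)"
    using delta_exact[OF _ qm_exact_eisenstein(3)] by (simp add: v_eisenstein kappa_def \<beta>_def mult.commute)
  have E4_E2: "\<delta> (E4 * E2) = (- 1 / 3) *\<^sub>Q (E6 * E2) + (\<beta> * (4 - 3 * \<alpha>)) *\<^sub>Q (E4 * E2 * E2)"
  proof -
    have "\<delta> (E4 * E2) = v (E4 * E2) + (b * c * kappa \<alpha> (4 + 2) (0 + 1)) *\<^sub>Q (E4 * E2 * E2)"
      by (rule delta_exact[OF _ qm_exact_mult[OF qm_exact_eisenstein(2,1)]]) simp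
    also have "\<dots> = (- 1 / 3) *\<^sub>Q (E6 * E2) + (\<beta> * (4 - 3 * \<alpha>)) *\<^sub>Q (E4 * E2 * E2)"
      by (simp add: v_mult v_eisenstein kappa_def \<beta>_def quasimodular_pointwise algebra_simps)
    finally show ?thesis .
  qed
  \<comment> \<open>The upper entry is \<open>kappa\<close> of E4 plus n - 1, that is 4 + 2 - 1 =
    5.\<close>
  have binomials: "(5 :: complex) gchoose Suc (Suc 0) = 10" "(5 :: complex) gchoose Suc 0 = 5"
    by (simp_all add: gbinomial_prod_rev)
  have "\<mu> 2 E4 E4 = (\<Sum>r\<le>2. ((- 1) ^ r * ((kappa \<alpha> 4 0 + of_nat 2 - 1) gchoose (2 - r)) *
      ((kappa \<alpha> 4 0 + of_nat 2 - 1) gchoose r)) *\<^sub>Q ((\<delta> ^^ r) E4 * (\<delta> ^^ (2 - r)) E4))"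
    by (rule rankin_cohen_familyD[OF \<mu> _ _ qm_exact_eisenstein(2,2)]) simp_all
  also have "\<dots> = 20 *\<^sub>Q (E4 * \<delta> (\<delta> E4)) - 25 *\<^sub>Q (\<delta> E4 * \<delta> E4)"
    by (simp add: kappa_def numeral_2_eq_2 binomials quasimodular_pointwise)
  \<comment> \<open>The terms linear in \<beta> cancel. On E4^2 E2^2 the coefficient is 20 * 4 (4 -
    3 \<alpha>) - 25 * 16 = - 80 (1 + 3 \<alpha>), times \<beta>^2.\<close>
  also have "\<dots> = (10 / 3) *\<^sub>Q E4 ^ 3 + (- 25 / 9) *\<^sub>Q E6 ^ 2 - (80 * \<beta> ^ 2 * (1 + 3 * \<alpha>)) *\<^sub>Q (E4 ^ 2 * E2 ^ 2)"
    unfolding E4 delta_linear E6 E4_E2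
    by (simp add: quasimodular_pointwise) (simp add: power2_eq_square power3_eq_cube field_simps)
  finally have bracket: "\<mu> 2 E4 E4 = \<dots>" .
  \<comment> \<open>E4 has depth 0, so compatibility would make the bracket a modular form of weight
    12.\<close>
  have "E4 \<in> qm_le 4 0" "even (4 :: nat)"
    using qm_exact_imp_qm_le[OF qm_exact_eisenstein(2)] by simp_all
  then have "\<mu> 2 E4 E4 \<in> qm_le (4 + 4 + 2 * 2) (0 + 0)"
    using compatible unfolding weight_depth_compatible_def by blast
  then have "\<mu> 2 E4 E4 \<in> quasimodular.span {E4 ^ 3, E6 ^ 2}"
    by (simp add: qm_le_0 modular_forms_eq_span)
  then obtain x y where "\<mu> 2 E4 E4 = x *\<^sub>Q E4 ^ 3 + y *\<^sub>Q E6 ^ 2"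
    by (auto simp: quasimodular.span_insert quasimodular.span_singleton algebra_simps)
  then have "(10 / 3 - x) *\<^sub>Q E4 ^ 3 + (- 25 / 9 - y) *\<^sub>Q E6 ^ 2 +
      (- (80 * \<beta> ^ 2 * (1 + 3 * \<alpha>))) *\<^sub>Q (E4 ^ 2 * E2 ^ 2) = 0"
    unfolding bracket by (simp add: quasimodular_pointwise algebra_simps)
  then have "- (80 * \<beta> ^ 2 * (1 + 3 * \<alpha>)) = 0"
    by (rule E4_E2_square_independent)
  moreover have "1 + 3 * \<alpha> \<noteq> 0"
    using assms(3) by (auto simp: add_eq_0_iff field_simps)
  ultimately show False
    using assms(1,2) by (simp add: \<beta>_def)
qed

end

text \<open>The alternative \<alpha> = - 1 / 3 in the equivalence is forced: there the brackets are
  the same for every b, so they remain compatible with weight and depth even when b is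
  nonzero.\<close>

theorem theoremB:
  fixes \<alpha> b :: complex
    and P :: "quasimodular \<Rightarrow> quasimodular \<Rightarrow> quasimodular"
    and \<pi> :: "quasimodular \<Rightarrow> quasimodular"
  assumes "alpha_bracket \<alpha> P"
    and "generator_of_line \<pi> (pi_space \<alpha>)"
  shows "(\<forall>k l s t. even k \<longrightarrow> even l \<longrightarrow> (\<forall>f \<in> qm_exact k s. \<forall>g \<in> qm_exact l t.
            P f g = kappa \<alpha> k s *\<^sub>Q (f * delta_derivation P \<pi> b g)
                  - kappa \<alpha> l t *\<^sub>Q (g * delta_derivation P \<pi> b f))) \<and>
         (\<forall>\<mu>. rankin_cohen_family \<alpha> (delta_derivation P \<pi> b) \<mu> \<longrightarrow>
            (formal_deformation \<mu> \<and> weight_depth_compatible \<mu> \<longleftrightarrow> b = 0 \<or> \<alpha> = - 1 / 3))"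
proof -
  obtain c where c: "c \<noteq> 0"
    "\<And>k s f. even k \<Longrightarrow> f \<in> qm_exact k s \<Longrightarrow> \<pi> f = (c * kappa \<alpha> k s) *\<^sub>Q (f * E2)" "derivation \<pi>"
    using pi_space_generator[OF assms(2)] by blast
  interpret alpha_poisson_generator \<alpha> P \<pi> b c
    using assms(1) c by unfold_locales auto
  show ?thesis
  proof (intro conjI allI impI ballI)
    fix k l s t f g
    assume "even k" "even l" "f \<in> qm_exact k s" "g \<in> qm_exact l t"
    then show "P f g = kappa \<alpha> k s *\<^sub>Q (f * \<delta> g) - kappa \<alpha> l t *\<^sub>Q (g * \<delta> f)"
      by (rule P_eq_delta)
  next
    fix \<mu>
    assume \<mu>: "rankin_cohen_family \<alpha> \<delta> \<mu>"
    show "formal_deformation \<mu> \<and> weight_depth_compatible \<mu> \<longleftrightarrow> b = 0 \<or> \<alpha> = - 1 / 3"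
    proof
      assume "formal_deformation \<mu> \<and> weight_depth_compatible \<mu>"
      then show "b = 0 \<or> \<alpha> = - 1 / 3"
        using not_weight_depth_compatible[OF _ c(1) _ \<mu>] by auto
    next
      assume "b = 0 \<or> \<alpha> = - 1 / 3"
      then have "rankin_cohen_family \<alpha> v \<mu>"
        using \<mu> by (rule rankin_cohen_family_delta_imp_v)
      then show "formal_deformation \<mu> \<and> weight_depth_compatible \<mu>"
        using formal_deformation_v weight_depth_compatible_v by simp
    qed
  qed
qed

end
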